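(* Let $m\ge 1$, $n\ge 2$, let $x_1\le x_2\le\dots\le x_m$ and $y_1\le y_2\le\dots\le y_n$ be real numbers, let $\mathbf X=(X_1,\dots,X_m)$ be an $m$-dimensional coalescing Brownian motion started at $(x_1,\dots,x_m)$ and let $\mathbf Y=(Y_1,\dots,Y_n)$ be an $n$-dimensional coalescing Brownian motion started at $(y_1,\dots,y_n)$. For $1\le i\le m$, $1\le j\le n-1$ and $t\ge 0$ put $$I^{\rightarrow}_{ij}(t):=1\{X_i(t)\in(y_j,y_{j+1}]\},\qquad I^{\leftarrow}_{ij}(t):=1\{x_i\in(Y_j(t),Y_{j+1}(t)]\}.$$ Then for every $t\ge 0$ the $m\times(n-1)$ random array $(I^{\rightarrow}_{ij}(t))_{i,j}$ has the same joint distribution as the $m\times(n-1)$ random array $(I^{\leftarrow}_{ij}(t))_{i,j}$.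
   Context: An $m$-dimensional coalescing Brownian motion started at $(x_1,\dots,x_m)$ with $x_1\le\dots\le x_m$ is the $\mathbb R^m$-valued Markov process $(X_1,\dots,X_m)$ described as follows: particle $i$ starts at $x_i$; the particles move as independent standard one-dimensional Brownian motions until two particles occupy the same location; at that moment the particle with the higher index is attached to the particle with the lower index and thereafter moves together with it (it stays equal to it forever), while free particles continue to move independently; the evolution continues in the same fashion. Particles with equal initial positions are considered attached from time 0. Equivalently, each $X_i$ is a Brownian motion in the filtration of $\mathbf X$ and each $(X_j-X_i)/\sqrt2$ is a Brownian motion in that filtration stopped upon hitting $0$. Notation: $1\{B\}$ is the indicator of the set/event $B$. *)

theory Defs
  imports "HOL-Probability.Probability"
begin

definition indep_std_BMs :: "'a measure \<Rightarrow> nat \<Rightarrow> (nat \<Rightarrow> real \<Rightarrow> 'a \<Rightarrow> real) \<Rightarrow> bool" where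
  "indep_std_BMs M m W \<longleftrightarrow>
     prob_space M \<and>
     (\<forall>i\<in>{1..m}. \<forall>t\<ge>0. W i t \<in> borel_measurable M) \<and>
     (\<forall>\<omega>\<in>space M. \<forall>i\<in>{1..m}. W i 0 \<omega> = 0 \<and> continuous_on {0..} (\<lambda>t. W i t \<omega>)) \<and>
     (\<forall>(ts :: nat \<Rightarrow> real) (k :: nat). (\<forall>l<k. 0 \<le> ts l \<and> ts l < ts (Suc l)) \<longrightarrow>
        prob_space.indep_vars M (\<lambda>_. borel)
           (\<lambda>(i, l) \<omega>. W i (ts (Suc l)) \<omega> - W i (ts l) \<omega>) ({1..m} \<times> {..<k}) \<and>
        (\<forall>i\<in>{1..m}. \<forall>l<k. distributed M lborel
           (\<lambda>\<omega>. W i (ts (Suc l)) \<omega> - W i (ts l) \<omega>)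
           (normal_density 0 (sqrt (ts (Suc l) - ts l)))))"

text \<open>Pathwise coalescing rule. Given the paths P 1, ..., P i of the particles 1..i,
the new particle i+1 starts at x0 and moves as x0 + b(t) (b its driving path) until the
first time tau it meets one of the particles 1..i; from then on it is attached to the
lowest-indexed particle it met and moves together with it forever.\<close>
definition coal_next :: "real \<Rightarrow> (real \<Rightarrow> real) \<Rightarrow> (nat \<Rightarrow> real \<Rightarrow> real) \<Rightarrow> nat \<Rightarrow> real \<Rightarrow> real" where
  "coal_next x0 b P i t =
     (let H = {s. 0 \<le> s \<and> (\<exists>k\<in>{1..i}. x0 + b s = P k s)};
          \<tau> = Inf H;
          k = (LEAST k. k \<in> {1..i} \<and> P k \<tau> = x0 + b \<tau>)
      in if H = {} \<or> t < \<tau> then x0 + b t else P k t)"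

primrec coal_upto :: "(nat \<Rightarrow> real) \<Rightarrow> (nat \<Rightarrow> real \<Rightarrow> real) \<Rightarrow> nat \<Rightarrow> nat \<Rightarrow> real \<Rightarrow> real" where
  "coal_upto x w 0 = (\<lambda>k t. 0)"
| "coal_upto x w (Suc i) =
     (let P = coal_upto x w i in P(Suc i := coal_next (x (Suc i)) (w (Suc i)) P i))"

definition coalescing_BM :: "(nat \<Rightarrow> real) \<Rightarrow> (nat \<Rightarrow> real \<Rightarrow> 'a \<Rightarrow> real) \<Rightarrow> nat \<Rightarrow> real \<Rightarrow> 'a \<Rightarrow> real" where
  "coalescing_BM x W i t \<omega> = coal_upto x (\<lambda>k s. W k s \<omega>) i i t"

end

theory Submission
  imports Defs "Jordan_Normal_Form.Determinant"
begin

text \<open>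
  For \<open>t > 0\<close> both \<open>P(X\<^sub>i(t) \<le> y\<^sub>i for all i \<le> k)\<close> and \<open>P(x\<^sub>i \<le> Y\<^sub>i(t) for all i \<le> k)\<close> equal the
  determinant of the matrix \<open>\<Phi>((y\<^sub>j - x\<^sub>i) / \<surd>t) - 1{i < j}\<close> (Warren's formula), and events of this
  kind, with repetitions among the \<open>y\<^sub>j\<close> allowed, determine the law of the array.

  The determinant is a martingale of the coalescing flow. If two neighbouring rows belong to
  particles at the same place, their difference is a unit vector, so the determinant is affine in
  the row of each cluster; hence letting the clusters move freely over a time step preserves its
  expectation exactly, by the semigroup property of the Gaussian kernel. The true motion
  differs from the free motion of the clusters only in steps where two clusters merge, and there
  are at most \<open>m - 1\<close> of these, so the total error vanishes as the mesh tends to zero. No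
  stochastic calculus and no strong Markov property is needed. At the terminal time the determinant of the
  0-1 matrix is the indicator of the event. The statement for \<open>Y\<close> is the same one after
  reflecting the matrix in its antidiagonal.
\<close>

section \<open>The determinant\<close>

text \<open>Subtracting 1{i < j} is what turns collision into coalescence: when neighbouring rows of
  kernels agree, 1{i - 1 < j} - 1{i < j} = 1{i = j} survives. Without the shift the determinant
  would vanish at a collision, as in the Karlin-McGregor formula for particles that are killed when
  they meet. The kernel is Lipschitz only at positive remaining time. Hence an extra time
  \<open>\<delta>\<close> is kept in it, which makes the constant uniform over all steps;
  \<open>\<delta>\<close> tends to 0 only at the end, where X_i(t) almost surely avoids every y_j.
  The arrays are one and the same function of the random sets of pairs (i, j) with X_i(t) \<le> y_j
  and with x_i \<le> Y_j(t). The law of a random subset of a finite set is fixed by its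
  probabilities of containing a given S. Since both relations pass to smaller i and larger j,
  containing S amounts to one condition for each i \<le> k, with y_j chosen by a nondecreasing map
  from i to j. This is where repeated y_j come from. Time 0, where the kernel degenerates, is
  settled directly.\<close>

definition shifted_det :: "nat \<Rightarrow> (nat \<Rightarrow> nat \<Rightarrow> real) \<Rightarrow> real" where
  "shifted_det k A = Determinant.det (Matrix.mat k k (\<lambda>(i, j). A i j - of_bool (i < j)))"

lemma permutes_atLeastLessThan_less:
  fixes k :: nat
  assumes "p permutes {0..<k}" "i < k"
  shows "p i < k"
  using permutes_in_image[OF assms(1), of i] assms(2) by auto

lemma shifted_det_leibniz:
  "shifted_det k A =
     (\<Sum>p | p permutes {0..<k}. signof p * (\<Prod>i = 0..<k. A i (p i) - of_bool (i < p i)))"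
  unfolding shifted_det_def
  by (subst det_def'[where n=k]) (auto intro!: sum.cong prod.cong simp: permutes_atLeastLessThan_less)

lemma shifted_det_cong:
  assumes "\<And>i j. i < k \<Longrightarrow> j < k \<Longrightarrow> A i j = B i j"
  shows "shifted_det k A = shifted_det k B"
  unfolding shifted_det_def
  by (rule arg_cong[where f="Determinant.det"], rule eq_matI) (use assms in auto)

text \<open>After the shift, equal neighbouring rows of \<open>A\<close> differ by a unit vector; the reduced matrix
  shows that the determinant is affine in the common row.\<close>
lemma shifted_det_reduce:
  assumes NL: "\<And>i. i \<in> NL \<Longrightarrow> 0 < i"
    and eq: "\<And>i j. i \<in> NL \<Longrightarrow> i < k \<Longrightarrow> j < k \<Longrightarrow> A i j = A (i - 1) j"
  shows "shifted_det k A =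
    Determinant.det (Matrix.mat k k (\<lambda>(i, j). if i \<in> NL then of_bool (i = j) else A i j - of_bool (i < j)))"
proof -
  \<comment> \<open>Only rows from \<open>r\<close> on are reduced. Working from the bottom row
    upwards keeps row \<open>r - 1\<close> in its original form when it is subtracted from row
    \<open>r\<close>.\<close>
  define R where "R r = Matrix.mat k k (\<lambda>(i, j). if i \<in> NL \<and> r \<le> i then of_bool (i = j)
    else A i j - of_bool (i < j))" for r
  have step: "Determinant.det (R (k - d)) = shifted_det k A" if "d \<le> k" for d
    using that
  proof (induction d)
    case 0
    show ?case unfolding R_def shifted_det_def
      by (rule arg_cong[where f="Determinant.det"], rule eq_matI) auto
  next
    case (Suc d)
    define r where "r = k - Suc d"
    have r: "r < k" "k - d = Suc r" using Suc.prems by (auto simp: r_def)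
    show ?case
    proof (cases "r \<in> NL")
      case False
      have "R r = R (Suc r)" unfolding R_def
        by (rule eq_matI) (use False in \<open>auto simp: Suc_le_eq order.order_iff_strict\<close>)
      then show ?thesis using Suc r by (simp add: r_def[symmetric])
    next
      case True
      have r0: "0 < r" using NL True by auto
      \<comment> \<open>The kernel entries cancel and 1{r - 1 < j} - 1{r < j} = 1{j = r} is
        left.\<close>
      have "R r = addrow (-1) r (r - 1) (R (Suc r))"
      proof (rule eq_matI)
        fix i j assume "i < dim_row (addrow (-1) r (r - 1) (R (Suc r)))"
          "j < dim_col (addrow (-1) r (r - 1) (R (Suc r)))"
        then have ij: "i < k" "j < k" by (auto simp: R_def)
        show "R r $$ (i, j) = addrow (-1) r (r - 1) (R (Suc r)) $$ (i, j)"
        proof (cases "i = r")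
          case i: True
          have "A r j = A (r - 1) j" using eq[OF True r(1) ij(2)] .
          then show ?thesis using ij r r0 i True by (auto simp: R_def)
        next
          case False
          then show ?thesis using ij r by (auto simp: R_def Suc_le_eq order.order_iff_strict)
        qed
      qed (auto simp: R_def)
      then have "Determinant.det (R r) = Determinant.det (R (Suc r))"
        using r r0 by (simp add: det_addrow[where n=k] R_def)
      then show ?thesis using Suc r by (simp add: r_def[symmetric])
    qed
  qed
  have "shifted_det k A = Determinant.det (R 0)" using step[of k] by simp
  then show ?thesis by (simp add: R_def)
qed

text \<open>Reflection in the antidiagonal is a reversal of the rows, a transposition and another
  reversal. The two signs cancel, and i < j is equivalent to k - 1 - j < k - 1 - i, so the shift is
  preserved. This exchanges the roles of moving particles and fixed points.\<close>

lemma shifted_det_flip: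
  "shifted_det k A = shifted_det k (\<lambda>i j. A (k - 1 - j) (k - 1 - i))"
proof -
  define \<rho> where "\<rho> i = (if i < k then k - 1 - i else i)" for i
  have \<rho>: "\<rho> permutes {0..<k}"
    by (rule bij_imp_permutes[OF bij_betwI[where g=\<rho>]]) (auto simp: \<rho>_def)
  define B where "B = Matrix.mat k k (\<lambda>(i, j). A i j - of_bool (i < j))"
  define C where "C = Matrix.mat k k (\<lambda>(i, j). B $$ (\<rho> i, j))"
  define E where "E = Matrix.mat k k (\<lambda>(i, j). transpose_mat C $$ (\<rho> i, j))"
  have B: "B \<in> carrier_mat k k" and C: "C \<in> carrier_mat k k" by (auto simp: B_def C_def)
  have "Determinant.det E = signof \<rho> * Determinant.det (transpose_mat C)"
    unfolding E_def by (rule det_permute_rows[OF _ \<rho>]) (use C in auto)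
  also have "Determinant.det (transpose_mat C) = Determinant.det C" by (rule det_transpose[OF C])
  also have "Determinant.det C = signof \<rho> * Determinant.det B"
    unfolding C_def by (rule det_permute_rows[OF B \<rho>])
  finally have "Determinant.det E = Determinant.det B"
    by (simp add: sign_def)
  moreover have "E = Matrix.mat k k (\<lambda>(i, j). A (k - 1 - j) (k - 1 - i) - of_bool (i < j))"
    by (rule eq_matI) (auto simp: E_def C_def B_def \<rho>_def)
  ultimately show ?thesis by (simp add: shifted_det_def B_def)
qed

text \<open>If the diagonal holds, monotonicity fills the upper triangle with ones, which the shift
  cancels: the matrix is unit lower triangular. If \<open>R r r\<close> fails, then so does
  \<open>R i j\<close> for all i \<ge> r \<ge> j, and the shift is 0 there. This zero block has k -
  r rows and r + 1 columns, too large for a nonzero Leibniz term.\<close>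

lemma shifted_det_indicator:
  assumes mono: "\<And>i j i' j'. R i j \<Longrightarrow> i' \<le> i \<Longrightarrow> j \<le> j' \<Longrightarrow> i < k \<Longrightarrow> j' < k \<Longrightarrow> R i' j'"
  shows "shifted_det k (\<lambda>i j. of_bool (R i j)) = of_bool (\<forall>i<k. R i i)"
proof (cases "\<forall>i<k. R i i")
  case True
  define B where "B = Matrix.mat k k (\<lambda>(i, j). of_bool (R i j) - of_bool (i < j) :: real)"
  have "Determinant.det B = prod_list (diag_mat B)"
  proof (rule det_lower_triangular)
    fix i j assume "i < j" "j < k"
    then show "B $$ (i, j) = 0" using True mono[of i i i j] by (simp add: B_def)
  qed (simp add: B_def)
  also have "prod_list (diag_mat B) = 1" using True by (auto simp: prod_list_diag_prod B_def)
  finally show ?thesis using True by (simp add: shifted_det_def B_def)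
next
  case False
  then obtain r where r: "r < k" "\<not> R r r" by auto
  have "(\<Prod>i = 0..<k. of_bool (R i (p i)) - of_bool (i < p i) :: real) = 0" if p: "p permutes {0..<k}" for p
  proof -
    \<comment> \<open>Pigeonhole: the k - r rows from \<open>r\<close> on do not fit injectively
      into the k - r - 1 columns beyond \<open>r\<close>.\<close>
    have "\<exists>i\<in>{r..<k}. p i \<le> r"
    proof (rule ccontr)
      assume "\<not> ?thesis"
      then have "p ` {r..<k} \<subseteq> {Suc r..<k}" using permutes_atLeastLessThan_less[OF p] by (auto simp: not_le Suc_le_eq)
      moreover have "inj_on p {r..<k}" using permutes_inj[OF p] by (rule inj_on_subset) auto
      ultimately have "card {r..<k} \<le> card {Suc r..<k}" by (intro card_inj_on_le) auto
      then show False using r by simp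
    qed
    then obtain i where i: "r \<le> i" "i < k" "p i \<le> r" by auto
    have "\<not> R i (p i)" using mono[of i "p i" r r] i r by auto
    then show ?thesis using i by (intro prod_zero bexI[of _ i]) auto
  qed
  then have "shifted_det k (\<lambda>i j. of_bool (R i j)) = 0"
    unfolding shifted_det_leibniz by (intro sum.neutral) (simp del: prod_zero_iff)
  then show ?thesis using False by simp
qed

section \<open>Bounds, continuity and measurability of the determinant\<close>

lemma abs_diff_of_bool_le_1:
  fixes a :: real
  assumes "0 \<le> a" "a \<le> 1"
  shows "\<bar>a - of_bool b\<bar> \<le> 1"
  using assms by (cases b) auto

text \<open>All shifted entries lie in [-1, 1], so exchanging the \<open>k\<close> factors of a
  Leibniz product one at a time costs at most \<open>e\<close> each; there are k! products.\<close>

lemma shifted_det_diff_bound: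
  assumes "\<And>i j. i < k \<Longrightarrow> j < k \<Longrightarrow> 0 \<le> A i j \<and> A i j \<le> 1 \<and> 0 \<le> B i j \<and> B i j \<le> 1"
    and "\<And>i j. i < k \<Longrightarrow> j < k \<Longrightarrow> \<bar>A i j - B i j\<bar> \<le> e"
  shows "\<bar>shifted_det k A - shifted_det k B\<bar> \<le> fact k * (real k * e)"
proof -
  let ?P = "{p. p permutes {0..<k}}"
  let ?t = "\<lambda>A p. signof p * (\<Prod>i = 0..<k. A i (p i) - of_bool (i < p i)) :: real"
  have "\<bar>?t A p - ?t B p\<bar> \<le> real k * e" if p: "p \<in> ?P" for p
  proof -
    have pk: "p i < k" if "i < k" for i using p permutes_atLeastLessThan_less[of p k i] that by auto
    have "\<bar>?t A p - ?t B p\<bar> = norm ((\<Prod>i = 0..<k. A i (p i) - of_bool (i < p i)) - (\<Prod>i = 0..<k. B i (p i) - of_bool (i < p i)))"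
      by (simp add: sign_def abs_minus_commute)
    also have "\<dots> \<le> (\<Sum>i = 0..<k. norm ((A i (p i) - of_bool (i < p i)) - (B i (p i) - of_bool (i < p i))))"
      by (rule norm_prod_diff; use assms(1) pk in \<open>simp add: abs_diff_of_bool_le_1\<close>)
    also have "\<dots> \<le> (\<Sum>i = 0..<k. e)"
      by (rule sum_mono) (use assms(2) pk in auto)
    finally show ?thesis by simp
  qed
  then have "\<bar>\<Sum>p\<in>?P. ?t A p - ?t B p\<bar> \<le> (\<Sum>p\<in>?P. real k * e)"
    by (intro order.trans[OF sum_abs] sum_mono) auto
  then show ?thesis
    by (simp add: shifted_det_leibniz sum_subtractf card_permutations[of _ k])
qed

lemma shifted_det_bound:
  assumes "\<And>i j. i < k \<Longrightarrow> j < k \<Longrightarrow> 0 \<le> A i j \<and> A i j \<le> 1"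
  shows "\<bar>shifted_det k A\<bar> \<le> fact k"
proof -
  let ?P = "{p. p permutes {0..<k}}"
  let ?t = "\<lambda>A p. signof p * (\<Prod>i = 0..<k. A i (p i) - of_bool (i < p i)) :: real"
  have "\<bar>?t A p\<bar> \<le> 1" if p: "p \<in> ?P" for p
  proof -
    have pk: "p i < k" if "i < k" for i using p permutes_atLeastLessThan_less[of p k i] that by auto
    have "\<bar>?t A p\<bar> = (\<Prod>i = 0..<k. \<bar>A i (p i) - of_bool (i < p i)\<bar>)"
      by (simp add: sign_def abs_prod)
    also have "\<dots> \<le> 1"
      by (rule prod_le_1) (use assms pk in \<open>simp add: abs_diff_of_bool_le_1\<close>)
    finally show ?thesis .
  qed
  then have "\<bar>\<Sum>p\<in>?P. ?t A p\<bar> \<le> (\<Sum>p\<in>?P. 1)"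
    by (intro order.trans[OF sum_abs] sum_mono) auto
  then show ?thesis
    by (simp add: shifted_det_leibniz card_permutations[of _ k])
qed

lemma tendsto_shifted_det:
  assumes "\<And>i j. i < k \<Longrightarrow> j < k \<Longrightarrow> ((\<lambda>n. A n i j) \<longlongrightarrow> B i j) F"
  shows "((\<lambda>n. shifted_det k (A n)) \<longlongrightarrow> shifted_det k B) F"
  unfolding shifted_det_leibniz
  by (intro tendsto_sum tendsto_mult tendsto_const tendsto_prod tendsto_diff assms)
    (auto simp: permutes_atLeastLessThan_less)

lemma borel_measurable_shifted_det:
  assumes "\<And>i j. i < k \<Longrightarrow> j < k \<Longrightarrow> (\<lambda>\<omega>. A \<omega> i j) \<in> borel_measurable M"
  shows "(\<lambda>\<omega>. shifted_det k (A \<omega>)) \<in> borel_measurable M"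
  unfolding shifted_det_leibniz
  by (intro borel_measurable_sum borel_measurable_times borel_measurable_prod borel_measurable_diff
      borel_measurable_const assms) (auto simp: permutes_atLeastLessThan_less)

section \<open>Coalescing paths\<close>

text \<open>Continuity makes the set of meeting times closed, so its infimum is attained and the
  \<open>LEAST\<close> index exists. The two cases hide \<open>Inf\<close> and \<open>LEAST\<close>
  from then on; that \<open>k\<close> is the lowest index is dropped, because particles sharing a
  place stay together anyway.\<close>

lemma coal_next_cases:
  assumes b: "continuous_on {0..} b" and P: "\<forall>k\<in>{1..i}. continuous_on {0..} (P k)"
  obtains
    (free) "\<And>s k. 0 \<le> s \<Longrightarrow> k \<in> {1..i} \<Longrightarrow> x0 + b s \<noteq> P k s"
      "\<And>t. coal_next x0 b P i t = x0 + b t"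
  | (hit) \<tau> k where "0 \<le> \<tau>" "k \<in> {1..i}" "x0 + b \<tau> = P k \<tau>"
      "\<And>s k. 0 \<le> s \<Longrightarrow> s < \<tau> \<Longrightarrow> k \<in> {1..i} \<Longrightarrow> x0 + b s \<noteq> P k s"
      "\<And>t. t < \<tau> \<Longrightarrow> coal_next x0 b P i t = x0 + b t"
      "\<And>t. \<tau> \<le> t \<Longrightarrow> coal_next x0 b P i t = P k t"
proof -
  define H where "H = {s. 0 \<le> s \<and> (\<exists>k\<in>{1..i}. x0 + b s = P k s)}"
  define \<tau> where "\<tau> = Inf H"
  define k where "k = (LEAST k. k \<in> {1..i} \<and> P k \<tau> = x0 + b \<tau>)"
  have cn: "coal_next x0 b P i t = (if H = {} \<or> t < \<tau> then x0 + b t else P k t)" for t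
    unfolding coal_next_def Let_def H_def \<tau>_def k_def ..
  show ?thesis
  proof (cases "H = {}")
    case True
    show ?thesis
      by (rule free) (use True cn in \<open>auto simp: H_def\<close>)
  next
    case False
    have "H = (\<Union>k\<in>{1..i}. {s \<in> {0..}. (x0 + b s) - P k s = 0})"
      by (auto simp: H_def)
    also have "closed \<dots>"
      by (intro closed_UN ballI continuous_closed_preimage_constant continuous_intros b P[rule_format]) auto
    finally have "closed H" .
    moreover have bdd: "bdd_below H" by (auto simp: H_def)
    ultimately have \<tau>H: "\<tau> \<in> H" unfolding \<tau>_def using False by (intro closed_contains_Inf)
    then have "\<exists>k. k \<in> {1..i} \<and> P k \<tau> = x0 + b \<tau>" by (force simp: H_def)
    then have k: "k \<in> {1..i} \<and> P k \<tau> = x0 + b \<tau>" unfolding k_def by (rule LeastI_ex)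
    have before: "x0 + b s \<noteq> P k' s" if "0 \<le> s" "s < \<tau>" "k' \<in> {1..i}" for s k'
    proof
      assume "x0 + b s = P k' s"
      then have "s \<in> H" using that by (auto simp: H_def)
      then have "\<tau> \<le> s" unfolding \<tau>_def using bdd by (rule cInf_lower)
      then show False using that by simp
    qed
    show ?thesis
      by (rule hit[of \<tau> k]) (use False cn \<tau>H k before in \<open>auto simp: H_def\<close>)
  qed
qed

text \<open>By sortedness a particle can only meet its left neighbour first, so the last clause describes
  the evolution without the hitting time and the index of the particle that is hit.\<close>
definition coalescing_paths ::
  "(nat \<Rightarrow> real) \<Rightarrow> (nat \<Rightarrow> real \<Rightarrow> real) \<Rightarrow> nat \<Rightarrow> (nat \<Rightarrow> real \<Rightarrow> real) \<Rightarrow> bool" where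
  "coalescing_paths x w m P \<longleftrightarrow>
     (\<forall>k\<in>{1..m}. continuous_on {0..} (P k) \<and> P k 0 = x k) \<and>
     (\<forall>j\<in>{1..m}. \<forall>k\<in>{1..m}. j \<le> k \<longrightarrow> (\<forall>t\<ge>0. P j t \<le> P k t)) \<and>
     (\<forall>j\<in>{1..m}. \<forall>k\<in>{1..m}. \<forall>s\<ge>0. \<forall>t\<ge>s. P j s = P k s \<longrightarrow> P j t = P k t) \<and>
     (\<forall>k\<in>{1..m}. \<forall>t\<ge>0. P k t =
        (if 1 < k \<and> (\<exists>s\<in>{0..t}. x k + w k s \<le> P (k - 1) s) then P (k - 1) t else x k + w k t))"

lemma coalescing_pathsD:
  assumes "coalescing_paths x w m P"
  shows "k \<in> {1..m} \<Longrightarrow> continuous_on {0..} (P k)"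
    and "k \<in> {1..m} \<Longrightarrow> P k 0 = x k"
    and "j \<in> {1..m} \<Longrightarrow> k \<in> {1..m} \<Longrightarrow> j \<le> k \<Longrightarrow> 0 \<le> t \<Longrightarrow> P j t \<le> P k t"
    and "j \<in> {1..m} \<Longrightarrow> k \<in> {1..m} \<Longrightarrow> 0 \<le> s \<Longrightarrow> s \<le> t \<Longrightarrow> P j s = P k s \<Longrightarrow> P j t = P k t"
    and "k \<in> {1..m} \<Longrightarrow> 0 \<le> t \<Longrightarrow> P k t =
        (if 1 < k \<and> (\<exists>s\<in>{0..t}. x k + w k s \<le> P (k - 1) s) then P (k - 1) t else x k + w k t)"
proof -
  note P = assms[unfolded coalescing_paths_def]
  note P1 = P[THEN conjunct1, rule_format]
    and P2 = P[THEN conjunct2, THEN conjunct1, rule_format]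
    and P3 = P[THEN conjunct2, THEN conjunct2, THEN conjunct1, rule_format]
    and P4 = P[THEN conjunct2, THEN conjunct2, THEN conjunct2, rule_format]
  show "k \<in> {1..m} \<Longrightarrow> continuous_on {0..} (P k)" by (rule P1[THEN conjunct1])
  show "k \<in> {1..m} \<Longrightarrow> P k 0 = x k" by (rule P1[THEN conjunct2])
  show "j \<in> {1..m} \<Longrightarrow> k \<in> {1..m} \<Longrightarrow> j \<le> k \<Longrightarrow> 0 \<le> t \<Longrightarrow> P j t \<le> P k t" by (rule P2)
  show "j \<in> {1..m} \<Longrightarrow> k \<in> {1..m} \<Longrightarrow> 0 \<le> s \<Longrightarrow> s \<le> t \<Longrightarrow> P j s = P k s \<Longrightarrow> P j t = P k t"
    by (rule P3)
  show "k \<in> {1..m} \<Longrightarrow> 0 \<le> t \<Longrightarrow> P k t =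
        (if 1 < k \<and> (\<exists>s\<in>{0..t}. x k + w k s \<le> P (k - 1) s) then P (k - 1) t else x k + w k t)"
    by (rule P4)
qed

text \<open>The new driver starts at or above particle \<open>i\<close>, the topmost so far, and
  stays strictly above it until they meet. A meeting with a lower particle \<open>k\<close>
  therefore forces \<open>P k\<close> and \<open>P i\<close> to coincide there and ever after, so
  following \<open>k\<close> is the same as following \<open>i\<close>.\<close>

lemma coalescing_paths_step:
  assumes P: "coalescing_paths x w i P"
    and w: "continuous_on {0..} (w (Suc i))" "w (Suc i) 0 = 0"
    and x: "1 \<le> i \<Longrightarrow> x i \<le> x (Suc i)"
  shows "coalescing_paths x w (Suc i) (P(Suc i := coal_next (x (Suc i)) (w (Suc i)) P i))"
proof -
  note Pc = coalescing_pathsD(1)[OF P] and P0 = coalescing_pathsD(2)[OF P]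
    and Ps = coalescing_pathsD(3)[OF P] and Pm = coalescing_pathsD(4)[OF P]
    and Pr = coalescing_pathsD(5)[OF P]
  define b where "b = w (Suc i)"
  define x0 where "x0 = x (Suc i)"
  define Q where "Q = coal_next x0 b P i"
  have b: "continuous_on {0..} b" "b 0 = 0" using w by (auto simp: b_def)
  \<comment> \<open>Intermediate value theorem: the driver cannot get below \<open>P i\<close>
    without meeting it.\<close>
  have above: "P i s < x0 + b s"
    if i: "1 \<le> i" and r: "0 \<le> s" "\<And>r. 0 \<le> r \<Longrightarrow> r \<le> s \<Longrightarrow> x0 + b r \<noteq> P i r" for s
  proof (rule ccontr)
    assume "\<not> ?thesis"
    then have "x0 + b s - P i s \<le> 0" by simp
    moreover have "0 \<le> x0 + b 0 - P i 0" using x i P0[of i] b by (simp add: x0_def)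
    moreover have "continuous_on {0..s} (\<lambda>r. x0 + b r - P i r)"
      by (intro continuous_intros continuous_on_subset[OF b(1)] continuous_on_subset[OF Pc]) (use i in auto)
    ultimately obtain r where "0 \<le> r" "r \<le> s" "x0 + b r - P i r = 0"
      using IVT2'[of "\<lambda>r. x0 + b r - P i r" s 0 0] r(1) by auto
    then show False using r(2)[of r] by simp
  qed
  have main: "continuous_on {0..} Q \<and> Q 0 = x0 \<and> (1 \<le> i \<longrightarrow> (\<forall>t\<ge>0. P i t \<le> Q t)) \<and>
    (\<forall>j\<in>{1..i}. \<forall>s\<ge>0. \<forall>t\<ge>s. Q s = P j s \<longrightarrow> Q t = P j t) \<and>
    (\<forall>t\<ge>0. Q t = (if 1 \<le> i \<and> (\<exists>s\<in>{0..t}. x0 + b s \<le> P i s) then P i t else x0 + b t))"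
  proof (cases rule: coal_next_cases[OF b(1), of i P x0, case_names cont free hit])
    case cont
    show ?case using Pc by blast
  next
    case free
    have Q: "Q = (\<lambda>t. x0 + b t)" using free(2) by (auto simp: Q_def)
    have ab: "P i s < x0 + b s" if "1 \<le> i" "0 \<le> s" for s
      by (rule above) (use that free(1) in auto)
    show ?thesis
      unfolding Q
    proof (intro conjI ballI allI impI)
      show "continuous_on {0..} (\<lambda>t. x0 + b t)" by (intro continuous_intros b)
      show "P i t \<le> x0 + b t" if "1 \<le> i" "0 \<le> t" for t using ab[OF that] by simp
      show "x0 + b t = P j t" if "j \<in> {1..i}" "0 \<le> s" "s \<le> t" "x0 + b s = P j s" for j s t
        using free(1)[OF that(2,1)] that(4) by simp
      show "x0 + b t = (if 1 \<le> i \<and> (\<exists>s\<in>{0..t}. x0 + b s \<le> P i s) then P i t else x0 + b t)"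
        if "0 \<le> t" for t
        using ab by (auto simp: not_le[symmetric])
    qed (use b in simp)
  next
    case (hit \<tau> k)
    have i: "1 \<le> i" "i \<in> {1..i}" using hit(2) by auto
    have ab: "P i s < x0 + b s" if "0 \<le> s" "s < \<tau>" for s
      by (rule above) (use that hit(4) i in auto)
    \<comment> \<open>The strict inequality before \<open>\<tau>\<close> passes to the left limit;
      for \<open>\<tau>\<close> = 0 there is no left limit and the order of the starting points is
      used.\<close>
    have "P i \<tau> \<le> x0 + b \<tau>"
    proof (cases "\<tau> = 0")
      case True
      then show ?thesis using x i P0[of i] b by (simp add: x0_def)
    next
      case False
      have "continuous_on {0..\<tau>} (\<lambda>r. x0 + b r - P i r)"
        by (intro continuous_intros continuous_on_subset[OF b(1)] continuous_on_subset[OF Pc]) (use i in auto)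
      then have "((\<lambda>r. x0 + b r - P i r) \<longlongrightarrow> x0 + b \<tau> - P i \<tau>) (at \<tau> within {0..\<tau>})"
        using hit(1) by (auto simp: continuous_on)
      then have "((\<lambda>r. x0 + b r - P i r) \<longlongrightarrow> x0 + b \<tau> - P i \<tau>) (at_left \<tau>)"
        using hit(1) False by (simp add: at_within_Icc_at_left)
      then have "0 \<le> x0 + b \<tau> - P i \<tau>"
      proof (rule tendsto_lowerbound)
        show "\<forall>\<^sub>F r in at_left \<tau>. 0 \<le> x0 + b r - P i r"
          unfolding eventually_at_left_field using hit(1) False ab
          by (intro exI[of _ 0]) (force simp: less_imp_le)
      qed simp
      then show ?thesis by simp
    qed
    \<comment> \<open>Sandwich: \<open>P i \<tau>\<close> is at most the driver, which equals
      \<open>P k \<tau>\<close>, which is at most \<open>P i \<tau>\<close>.\<close>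
    then have ki: "P k \<tau> = P i \<tau>"
      using hit Ps[of k i \<tau>] i by auto
    have Q1: "Q t = x0 + b t" if "t < \<tau>" for t using hit(5) that by (simp add: Q_def)
    have Q2: "Q t = P i t" if "\<tau> \<le> t" for t
      using hit(6)[OF that] Pm[OF hit(2) i(2) hit(1) that ki] by (simp add: Q_def)
    have Q1': "Q t = x0 + b t" if "t \<le> \<tau>" for t
      using that Q1[of t] Q2[of t] hit(3) ki by (cases "t = \<tau>") auto
    have "continuous_on ({0..\<tau>} \<union> {\<tau>..}) Q"
    proof (rule continuous_on_closed_Un)
      show "continuous_on {0..\<tau>} Q"
        by (subst continuous_on_cong[OF refl Q1'])
          (auto intro!: continuous_intros continuous_on_subset[OF b(1)])
      show "continuous_on {\<tau>..} Q"
        by (subst continuous_on_cong[OF refl Q2])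
          (use hit(1) i in \<open>auto intro!: continuous_on_subset[OF Pc[of i]]\<close>)
    qed auto
    moreover have "{0..\<tau>} \<union> {\<tau>..} = {0..}" using hit(1) by auto
    ultimately have "continuous_on {0..} Q" by simp
    moreover have "Q 0 = x0" using Q1'[of 0] hit(1) b by simp
    moreover have "P i t \<le> Q t" if "0 \<le> t" for t
      using that Q1[of t] Q2[of t] ab[of t] by (cases "t < \<tau>") auto
    moreover have "Q t = P j t" if "j \<in> {1..i}" "0 \<le> s" "s \<le> t" "Q s = P j s" for j s t
    proof -
      have "\<tau> \<le> s" using that hit(4)[of s j] Q1[of s] by force
      then have "P i s = P j s" using that Q2[of s] by simp
      then show ?thesis using Pm[OF i(2) that(1,2,3)] Q2[of t] that \<open>\<tau> \<le> s\<close> by simp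
    qed
    moreover have "Q t = (if 1 \<le> i \<and> (\<exists>s\<in>{0..t}. x0 + b s \<le> P i s) then P i t else x0 + b t)" if "0 \<le> t" for t
    proof (cases "t < \<tau>")
      case True
      have "x0 + b s > P i s" if "s \<in> {0..t}" for s using ab[of s] that True by auto
      then show ?thesis using Q1[OF True] by (auto simp: not_le[symmetric])
    next
      case False
      then have "\<exists>s\<in>{0..t}. x0 + b s \<le> P i s" using hit(1,3) ki by (intro bexI[of _ \<tau>]) auto
      then show ?thesis using Q2[of t] False i by auto
    qed
    ultimately show ?thesis by blast
  qed
  have sorted: "P j t \<le> Q t" if "j \<in> {1..i}" "0 \<le> t" for j t
  proof -
    have i: "i \<in> {1..i}" "j \<le> i" using that by auto
    have "P j t \<le> P i t" by (rule Ps[OF that(1) i that(2)])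
    moreover have "1 \<le> i" using that by simp
    then have "P i t \<le> Q t" using main that(2) by blast
    ultimately show ?thesis by simp
  qed
  have "Q t = (if 1 < Suc i \<and> (\<exists>s\<in>{0..t}. x0 + b s \<le> P i s) then P i t else x0 + b t)" if "0 \<le> t" for t
    using main that by (simp add: less_Suc_eq_le Suc_le_eq)
  then have rec: "(P(Suc i := Q)) k t =
        (if 1 < k \<and> (\<exists>s\<in>{0..t}. x k + w k s \<le> (P(Suc i := Q)) (k - 1) s) then (P(Suc i := Q)) (k - 1) t else x k + w k t)"
    if "k \<in> {1..Suc i}" "0 \<le> t" for k t
  proof (cases "k = Suc i")
    case True then show ?thesis using that \<open>0 \<le> t \<Longrightarrow> Q t = _\<close> by (simp add: x0_def b_def)
  next
    case False then show ?thesis using Pr[of k t] that by auto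
  qed
  have Qm: "Q t = P j t" if "j \<in> {1..i}" "0 \<le> s" "s \<le> t" "Q s = P j s" for j s t
    using main that by blast
  have IS: "k \<in> {1..Suc i} \<longleftrightarrow> k \<in> {1..i} \<or> k = Suc i" for k by auto
  have "coalescing_paths x w (Suc i) (P(Suc i := Q))"
    unfolding coalescing_paths_def
  proof (intro conjI)
    show "\<forall>k\<in>{1..Suc i}. continuous_on {0..} ((P(Suc i := Q)) k) \<and> (P(Suc i := Q)) k 0 = x k"
      using main Pc P0 by (auto simp: IS x0_def)
    show "\<forall>j\<in>{1..Suc i}. \<forall>k\<in>{1..Suc i}. j \<le> k \<longrightarrow> (\<forall>t\<ge>0. (P(Suc i := Q)) j t \<le> (P(Suc i := Q)) k t)"
      using sorted Ps by auto
    show "\<forall>j\<in>{1..Suc i}. \<forall>k\<in>{1..Suc i}. \<forall>s\<ge>0. \<forall>t\<ge>s. (P(Suc i := Q)) j s = (P(Suc i := Q)) k s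
        \<longrightarrow> (P(Suc i := Q)) j t = (P(Suc i := Q)) k t"
    proof (intro ballI allI impI)
      fix j k s t assume jk: "j \<in> {1..Suc i}" "k \<in> {1..Suc i}" "0 \<le> s" "s \<le> t"
        and e: "(P(Suc i := Q)) j s = (P(Suc i := Q)) k s"
      show "(P(Suc i := Q)) j t = (P(Suc i := Q)) k t"
        using jk e Pm[of j k s t] Qm[of j s t] Qm[of k s t]
        by (cases "j = Suc i"; cases "k = Suc i") auto
    qed
    show "\<forall>k\<in>{1..Suc i}. \<forall>t\<ge>0. (P(Suc i := Q)) k t =
        (if 1 < k \<and> (\<exists>s\<in>{0..t}. x k + w k s \<le> (P(Suc i := Q)) (k - 1) s) then (P(Suc i := Q)) (k - 1) t else x k + w k t)"
      using rec by blast
  qed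
  then show ?thesis by (simp add: Q_def x0_def b_def)
qed

text \<open>Each stage of the recursion only adds a particle. \<open>coalescing_BM\<close> reads
  particle \<open>k\<close> from stage \<open>k\<close>, whereas statements about several particles
  need one common stage.\<close>

lemma coal_upto_eq_diag: "1 \<le> k \<Longrightarrow> k \<le> i \<Longrightarrow> coal_upto x w i k = coal_upto x w k k"
proof (induction i)
  case (Suc i)
  then show ?case by (cases "k = Suc i") (simp_all add: Let_def)
qed simp

lemma coalescing_paths_coal_upto:
  assumes "\<And>i. i \<in> {1..m} \<Longrightarrow> continuous_on {0..} (w i) \<and> w i 0 = 0"
    and "\<And>i. i \<in> {1..<m} \<Longrightarrow> x i \<le> x (Suc i)"
  shows "coalescing_paths x w m (\<lambda>i. coal_upto x w i i)"
proof -
  have "coalescing_paths x w i (coal_upto x w i)" if "i \<le> m" for i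
    using that
  proof (induction i)
    case 0
    show ?case by (simp add: coalescing_paths_def)
  next
    case (Suc i)
    then show ?case
      using coalescing_paths_step[of x w i "coal_upto x w i"] assms(1)[of "Suc i"] assms(2)[of i]
      by (simp add: Let_def fun_upd_def)
  qed
  from this[of m] have P: "coalescing_paths x w m (coal_upto x w m)" by simp
  have e: "coal_upto x w k k = coal_upto x w m k" if "k \<in> {1..m}" for k
    using coal_upto_eq_diag[of k m x w] that by simp
  show ?thesis
    unfolding coalescing_paths_def
  proof (intro conjI)
    show "\<forall>k\<in>{1..m}. \<forall>t\<ge>0. coal_upto x w k k t =
        (if 1 < k \<and> (\<exists>s\<in>{0..t}. x k + w k s \<le> coal_upto x w (k-1) (k - 1) s) then coal_upto x w (k - 1) (k-1) t else x k + w k t)"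
    proof (intro ballI allI impI)
      fix k t assume k: "k \<in> {1..m}" "(0::real) \<le> t"
      show "coal_upto x w k k t =
        (if 1 < k \<and> (\<exists>s\<in>{0..t}. x k + w k s \<le> coal_upto x w (k-1) (k - 1) s) then coal_upto x w (k - 1) (k-1) t else x k + w k t)"
      proof (cases "1 < k")
        case True
        then have "k - 1 \<in> {1..m}" using k by auto
        then show ?thesis using coalescing_pathsD(5)[OF P k] by (simp only: e[OF k(1)] e)
      next
        case False
        then show ?thesis using coalescing_pathsD(5)[OF P k] by (simp only: e[OF k(1)] if_False simp_thms)
      qed
    qed
    show "\<forall>k\<in>{1..m}. continuous_on {0..} (coal_upto x w k k) \<and> coal_upto x w k k 0 = x k"
      using coalescing_pathsD(1,2)[OF P] by (simp add: e)
    show "\<forall>j\<in>{1..m}. \<forall>k\<in>{1..m}. j \<le> k \<longrightarrow> (\<forall>t\<ge>0. coal_upto x w j j t \<le> coal_upto x w k k t)"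
      using coalescing_pathsD(3)[OF P] by (simp add: e)
    show "\<forall>j\<in>{1..m}. \<forall>k\<in>{1..m}. \<forall>s\<ge>0. \<forall>t\<ge>s. coal_upto x w j j s = coal_upto x w k k s \<longrightarrow>
        coal_upto x w j j t = coal_upto x w k k t"
    proof (intro ballI allI impI)
      fix j k s t assume jk: "j \<in> {1..m}" "k \<in> {1..m}" "(0::real) \<le> s" "s \<le> t"
        and eq: "coal_upto x w j j s = coal_upto x w k k s"
      show "coal_upto x w j j t = coal_upto x w k k t"
        using coalescing_pathsD(4)[OF P jk] eq by (simp only: e[OF jk(1)] e[OF jk(2)])
    qed
  qed
qed

text \<open>Attachment is permanent: had the particle ever been attached, it would now sit at the
  place of its left neighbour.\<close>

lemma coalescing_paths_driver:
  assumes P: "coalescing_paths x w m P" and k: "k \<in> {1..m}" and t: "0 \<le> t"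
    and free: "\<And>j. j \<in> {1..m} \<Longrightarrow> j < k \<Longrightarrow> P j t \<noteq> P k t"
  shows "P k t = x k + w k t"
proof (cases "1 < k")
  case True
  then have "k - 1 \<in> {1..m}" using k by auto
  then show ?thesis
    using coalescing_pathsD(5)[OF P k t] free[of "k - 1"] True by (auto split: if_splits)
qed (use coalescing_pathsD(5)[OF P k t] in auto)

text \<open>Following left neighbours down to a particle on its own driver leaves only finitely many
  Gaussian candidates for the position, whence the position has no atoms.\<close>

lemma coalescing_paths_range:
  assumes P: "coalescing_paths x w m P" and k: "k \<in> {1..m}" and t: "0 \<le> t"
  shows "\<exists>j\<in>{1..m}. P k t = x j + w j t"
  using k
proof (induction k rule: less_induct)
  case (less k)
  show ?case
  proof (cases "P k t = x k + w k t")
    case False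
    then have "P k t = P (k - 1) t" "1 < k"
      using coalescing_pathsD(5)[OF P less.prems t] by (auto split: if_splits)
    moreover from this have "k - 1 \<in> {1..m}" using less.prems by auto
    ultimately show ?thesis using less.IH[of "k - 1"] by auto
  qed (use less in auto)
qed

section \<open>The Gaussian kernel and the one-step identity\<close>

text \<open>The parameter is the variance, that is, elapsed time, so that parameters add under
  convolution.\<close>

abbreviation gauss :: "real \<Rightarrow> real measure" where
  "gauss s \<equiv> density lborel (normal_density 0 (sqrt s))"

definition gauss_cdf :: "real \<Rightarrow> real \<Rightarrow> real" where
  "gauss_cdf s d = measure (gauss s) {..d}"

lemma prob_space_gauss: "0 < s \<Longrightarrow> prob_space (gauss s)"
  by (rule prob_space_normal_density) simp

lemma gauss_cdf_bounds:
  assumes "0 < s"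
  shows "0 \<le> gauss_cdf s d" "gauss_cdf s d \<le> 1"
  using prob_space.prob_le_1[OF prob_space_gauss[OF assms]] by (auto simp: gauss_cdf_def)

text \<open>The density of \<open>gauss s\<close> is at most its value 1 / sqrt (2 * pi * s) at 0.
  The bound is expressed through \<open>\<delta>\<close> to be uniform over all variances from
  \<open>\<delta>\<close> on.\<close>

lemma gauss_cdf_lipschitz:
  assumes s: "0 < \<delta>" "\<delta> \<le> s"
  shows "\<bar>gauss_cdf s d - gauss_cdf s d'\<bar> \<le> \<bar>d - d'\<bar> / sqrt (2 * pi * \<delta>)"
proof -
  have s0: "0 < s" using s by simp
  interpret prob_space "gauss s" by (rule prob_space_gauss[OF s0])
  have *: "gauss_cdf s b - gauss_cdf s a \<le> (b - a) / sqrt (2 * pi * \<delta>) \<and> gauss_cdf s a \<le> gauss_cdf s b"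
    if ab: "a \<le> b" for a b
  proof -
    have split: "{..b} = {..a} \<union> {a<..b}" using ab by auto
    have "gauss_cdf s b = gauss_cdf s a + measure (gauss s) {a<..b}"
      unfolding gauss_cdf_def split by (rule finite_measure_Union) auto
    moreover have "measure (gauss s) {a<..b} \<le> (b - a) / sqrt (2 * pi * \<delta>)"
    proof -
      have "emeasure (gauss s) {a<..b} = (\<integral>\<^sup>+x. ennreal (normal_density 0 (sqrt s) x) * indicator {a<..b} x \<partial>lborel)"
        by (subst emeasure_density) auto
      also have "\<dots> \<le> (\<integral>\<^sup>+x. ennreal (1 / sqrt (2 * pi * \<delta>)) * indicator {a<..b} x \<partial>lborel)"
      proof (intro nn_integral_mono mult_right_mono ennreal_leI)
        fix x
        have "normal_density 0 (sqrt s) x \<le> 1 / sqrt (2 * pi * s) * 1"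
          unfolding normal_density_def using s0 by (intro mult_mono) auto
        also have "\<dots> \<le> 1 / sqrt (2 * pi * \<delta>)"
          using s by (auto intro!: divide_left_mono)
        finally show "normal_density 0 (sqrt s) x \<le> 1 / sqrt (2 * pi * \<delta>)" .
      qed auto
      also have "\<dots> = ennreal (1 / sqrt (2 * pi * \<delta>)) * ennreal (b - a)"
        using ab by (subst nn_integral_cmult_indicator) auto
      also have "\<dots> = ennreal ((b - a) / sqrt (2 * pi * \<delta>))"
        using ab s by (subst ennreal_mult[symmetric]) auto
      finally show ?thesis
        using ab s by (simp add: emeasure_eq_measure)
    qed
    ultimately show ?thesis by simp
  qed
  show ?thesis
    using *[of d d'] *[of d' d] by (cases "d \<le> d'") auto
qed

lemma continuous_gauss_cdf:
  assumes "0 < s"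
  shows "continuous_on UNIV (gauss_cdf s)"
proof -
  have "(1 / sqrt (2 * pi * s))-lipschitz_on UNIV (gauss_cdf s)"
    by (rule lipschitz_onI) (use assms gauss_cdf_lipschitz[OF assms order.refl] in \<open>auto simp: dist_real_def\<close>)
  then show ?thesis by (rule lipschitz_on_continuous_on)
qed

lemma borel_measurable_gauss_cdf:
  assumes "0 < s"
  shows "gauss_cdf s \<in> borel_measurable borel"
  using continuous_gauss_cdf[OF assms] by (rule borel_measurable_continuous_onI)

lemma gauss_cdf_convolution:
  assumes s: "0 < s" and h: "0 < h"
  shows "(\<integral>v. gauss_cdf s (d - v) \<partial>gauss h) = gauss_cdf (s + h) d"
proof -
  interpret S: prob_space "gauss s" by (rule prob_space_gauss[OF s])
  interpret H: prob_space "gauss h" by (rule prob_space_gauss[OF h])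
  interpret SH: prob_space "gauss (s + h)" by (rule prob_space_gauss) (use s h in simp)
  note [measurable] = borel_measurable_gauss_cdf[OF s]
  have conv: "gauss h \<star> gauss s = gauss (s + h)"
  proof -
    have "gauss h \<star> gauss s = density lborel (\<lambda>x. \<integral>\<^sup>+y. ennreal (normal_density 0 (sqrt h) (x - y)) * ennreal (normal_density 0 (sqrt s) y) \<partial>lborel)"
      by (rule convolution_density) (auto intro: S.finite_measure H.finite_measure)
    also have "(\<lambda>x. \<integral>\<^sup>+y. ennreal (normal_density 0 (sqrt h) (x - y)) * ennreal (normal_density 0 (sqrt s) y) \<partial>lborel) =
      (\<lambda>x. ennreal (normal_density 0 (sqrt ((sqrt h)\<^sup>2 + (sqrt s)\<^sup>2)) x))"
      using conv_normal_density_zero_mean[of "sqrt h" "sqrt s"] s h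
      by (simp add: ennreal_mult'')
    finally show ?thesis using s h by (simp add: add.commute)
  qed
  have "emeasure (gauss (s + h)) {..d} = (\<integral>\<^sup>+v. emeasure (gauss s) {a. a + v \<in> {..d}} \<partial>gauss h)"
    unfolding conv[symmetric]
    by (rule convolution_emeasure) (auto intro: S.finite_measure H.finite_measure)
  also have "\<dots> = (\<integral>\<^sup>+v. ennreal (gauss_cdf s (d - v)) \<partial>gauss h)"
  proof (rule nn_integral_cong)
    fix v
    have "{a. a + v \<in> {..d}} = {..d - v}" by auto
    then show "emeasure (gauss s) {a. a + v \<in> {..d}} = ennreal (gauss_cdf s (d - v))"
      by (simp add: gauss_cdf_def S.emeasure_eq_measure)
  qed
  also have "\<dots> = ennreal (\<integral>v. gauss_cdf s (d - v) \<partial>gauss h)"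
    by (intro nn_integral_eq_integral H.integrable_const_bound[where B=1] AE_I2)
       (use gauss_cdf_bounds[OF s] in auto)
  finally show ?thesis
    by (simp add: gauss_cdf_def SH.emeasure_eq_measure integral_nonneg_AE)
qed

lemma gauss_reflect:
  assumes h: "0 < h" and [measurable]: "f \<in> borel_measurable borel"
  shows "(\<integral>v. f (- v) \<partial>gauss h) = (\<integral>v. f v \<partial>gauss h :: real)"
proof -
  have "(\<integral>v. f v \<partial>gauss h) = (\<integral>v. normal_density 0 (sqrt h) v * f v \<partial>lborel)"
    by (subst integral_density) auto
  also have "\<dots> = (\<integral>v. normal_density 0 (sqrt h) (- v) * f (- v) \<partial>lborel)"
    by (subst lborel_integral_real_affine[where c="-1" and t=0]) auto
  also have "\<dots> = (\<integral>v. f (- v) \<partial>gauss h)"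
    by (subst integral_density) (auto simp: normal_density_def)
  finally show ?thesis ..
qed

text \<open>For \<open>\<epsilon>\<close> = 1 the noise enters with a minus sign, which is the
  convolution itself; for \<open>\<epsilon>\<close> = -1 it enters with a plus sign and the symmetry
  of the Gaussian law is needed.\<close>

lemma gauss_cdf_martingale:
  assumes s: "0 < s" and h: "0 < h" and \<epsilon>: "\<epsilon> = 1 \<or> \<epsilon> = - 1"
  shows "(\<integral>v. gauss_cdf s (\<epsilon> * (b - (a + v))) \<partial>gauss h) = gauss_cdf (s + h) (\<epsilon> * (b - a))"
proof -
  note [measurable] = borel_measurable_gauss_cdf[OF s]
  from \<epsilon> show ?thesis
  proof
    assume "\<epsilon> = 1"
    then show ?thesis
      using gauss_cdf_convolution[OF s h, of "b - a"] by (simp add: algebra_simps)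
  next
    assume \<epsilon>: "\<epsilon> = - 1"
    have "(\<integral>v. gauss_cdf s (a - b - v) \<partial>gauss h) = (\<integral>v. gauss_cdf s (a - b + v) \<partial>gauss h)"
      using gauss_reflect[OF h, of "\<lambda>v. gauss_cdf s (a - b + v)"] by simp
    then show ?thesis
      using gauss_cdf_convolution[OF s h, of "a - b"] \<epsilon> by (simp add: algebra_simps)
  qed
qed

lemma gauss_cdf_scale:
  assumes s: "0 < s"
  shows "gauss_cdf s d = cdf std_normal_distribution (d / sqrt s)"
proof -
  have "emeasure (gauss s) {..d} = (\<integral>\<^sup>+x. ennreal (normal_density 0 (sqrt s) x) * indicator {..d} x \<partial>lborel)"
    by (subst emeasure_density) auto
  also have "\<dots> = (\<integral>\<^sup>+x. ennreal (sqrt s) * (ennreal (normal_density 0 (sqrt s) (0 + sqrt s * x)) * indicator {..d} (0 + sqrt s * x)) \<partial>lborel)"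
    using s by (subst nn_integral_real_affine[where c="sqrt s" and t=0]) (auto simp: nn_integral_cmult)
  also have "\<dots> = (\<integral>\<^sup>+x. ennreal (std_normal_density x) * indicator {..d / sqrt s} x \<partial>lborel)"
  proof (rule nn_integral_cong)
    fix x
    have "sqrt s * normal_density 0 (sqrt s) (sqrt s * x) = std_normal_density x"
      using s by (simp add: normal_density_def power_mult_distrib real_sqrt_mult)
    moreover have "indicator {..d} (0 + sqrt s * x) = (indicator {..d / sqrt s} x :: ennreal)"
      using s by (auto simp: indicator_def field_simps)
    ultimately show "ennreal (sqrt s) * (ennreal (normal_density 0 (sqrt s) (0 + sqrt s * x)) * indicator {..d} (0 + sqrt s * x)) =
      ennreal (std_normal_density x) * indicator {..d / sqrt s} x"
      using s by (simp add: mult.assoc[symmetric] ennreal_mult''[symmetric])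
  qed
  also have "\<dots> = emeasure std_normal_distribution {..d / sqrt s}"
    by (subst emeasure_density) auto
  finally show ?thesis by (simp add: gauss_cdf_def cdf_def measure_def)
qed

text \<open>By scaling, the argument becomes \<open>d n / sqrt (s n)\<close>, which runs off to the
  infinity on the side of \<open>l\<close>. For l = 0 this quotient could do anything, so the limit
  point has to stay off the jump.\<close>

lemma tendsto_gauss_cdf_0:
  assumes s: "\<And>n. 0 < s n" "s \<longlonglongrightarrow> 0" and d: "d \<longlonglongrightarrow> l" and l: "l \<noteq> 0"
  shows "(\<lambda>n. gauss_cdf (s n) (d n)) \<longlonglongrightarrow> of_bool (0 \<le> l)"
proof -
  interpret real_distribution std_normal_distribution by (rule real_dist_normal_dist)
  have "(\<lambda>n. sqrt (s n)) \<longlonglongrightarrow> 0" using tendsto_real_sqrt[OF s(2)] by simp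
  then have inv: "filterlim (\<lambda>n. inverse (sqrt (s n))) at_top sequentially"
    by (intro filterlim_inverse_at_top) (use s(1) in auto)
  show ?thesis
  proof (cases "0 \<le> l")
    case True
    then have "0 < l" using l by simp
    from filterlim_tendsto_pos_mult_at_top[OF d this inv]
    have "filterlim (\<lambda>n. d n / sqrt (s n)) at_top sequentially" by (simp add: field_simps)
    from filterlim_compose[OF cdf_lim_at_top_prob this] show ?thesis
      using True s(1) by (simp add: gauss_cdf_scale)
  next
    case False
    then have "l < 0" by simp
    from filterlim_tendsto_neg_mult_at_bot[OF d this inv]
    have "filterlim (\<lambda>n. d n / sqrt (s n)) at_bot sequentially" by (simp add: field_simps)
    from filterlim_compose[OF cdf_lim_at_bot this] show ?thesis
      using False s(1) by (simp add: gauss_cdf_scale)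
  qed
qed

text \<open>In the expansion of the reduced matrix a cluster contributes a single kernel factor to
  each product, and so the products factorise over independent noises.\<close>

lemma shifted_det_reduce_leibniz:
  assumes "\<And>i. i \<in> NL \<Longrightarrow> 0 < i"
    and "\<And>i j. i \<in> NL \<Longrightarrow> i < k \<Longrightarrow> j < k \<Longrightarrow> A i j = A (i - 1) j"
  shows "shifted_det k A = (\<Sum>p | p permutes {0..<k}. signof p *
    (\<Prod>i = 0..<k. if i \<in> NL then of_bool (i = p i) else A i (p i) - of_bool (i < p i)))"
proof -
  let ?B = "Matrix.mat k k (\<lambda>(i, j). if i \<in> NL then of_bool (i = j) else A i j - of_bool (i < j))"
  have "shifted_det k A = Determinant.det ?B"
    by (rule shifted_det_reduce) (use assms in auto)
  also have "\<dots> = (\<Sum>p | p permutes {0..<k}. signof p *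
    (\<Prod>i = 0..<k. if i \<in> NL then of_bool (i = p i) else A i (p i) - of_bool (i < p i)))"
    by (subst det_def'[where n=k])
      (auto intro!: sum.cong prod.cong simp: permutes_atLeastLessThan_less)
  finally show ?thesis .
qed

text \<open>Factor \<open>i\<close> reads coordinate \<open>q i\<close>; injectivity of
  \<open>q\<close> makes the factors independent. Coordinates outside the range of \<open>q\<close>
  carry the constant 1, whose integral is 1 because \<open>N\<close> is a probability
  measure.\<close>

lemma integral_PiM_prod_reindex:
  fixes \<phi> :: "'i \<Rightarrow> real \<Rightarrow> real"
  assumes N: "prob_space N" and I: "finite I" and q: "inj_on q R" "q ` R \<subseteq> I"
    and \<phi>: "\<And>i. i \<in> R \<Longrightarrow> integrable N (\<phi> i)"
  shows "(\<integral>v. (\<Prod>i\<in>R. \<phi> i (v (q i))) \<partial>PiM I (\<lambda>_. N)) = (\<Prod>i\<in>R. \<integral>v. \<phi> i v \<partial>N)"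
proof -
  interpret N: prob_space N by (rule N)
  interpret product_sigma_finite "\<lambda>_. N" by unfold_locales
  define g where "g l = (if l \<in> q ` R then \<phi> (the_inv_into R q l) else (\<lambda>_. 1))" for l
  have gq: "g (q i) = \<phi> i" if "i \<in> R" for i
    using that q(1) by (simp add: g_def the_inv_into_f_f)
  \<comment> \<open>An arbitrary functional \<open>G\<close> covers both uses: the product of the
    values at \<open>v\<close> and the product of the integrals.\<close>
  have prod_g: "(\<Prod>l\<in>I. G (g l) l) = (\<Prod>i\<in>R. G (\<phi> i) (q i))" if "\<And>l. G (\<lambda>_. 1) l = 1" for G :: "(real \<Rightarrow> real) \<Rightarrow> _ \<Rightarrow> real"
  proof -
    have "(\<Prod>l\<in>I. G (g l) l) = (\<Prod>l\<in>q ` R. G (g l) l)"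
      by (rule prod.mono_neutral_right[OF I q(2)]) (auto simp: g_def that)
    also have "\<dots> = (\<Prod>i\<in>R. G (g (q i)) (q i))" by (rule prod.reindex_cong[OF q(1)]) auto
    finally show ?thesis using gq by simp
  qed
  have "integrable N (g l)" for l
    using \<phi> q(1) by (auto simp: g_def the_inv_into_f_f)
  then have "(\<integral>v. (\<Prod>l\<in>I. g l (v l)) \<partial>PiM I (\<lambda>_. N)) = (\<Prod>l\<in>I. \<integral>v. g l v \<partial>N)"
    by (intro product_integral_prod[OF I])
  moreover have "(\<Prod>l\<in>I. g l (v l)) = (\<Prod>i\<in>R. \<phi> i (v (q i)))" for v
    by (rule prod_g[of "\<lambda>f l. f (v l)"]) simp
  moreover have "(\<Prod>l\<in>I. \<integral>v. g l v \<partial>N) = (\<Prod>i\<in>R. \<integral>v. \<phi> i v \<partial>N)"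
    by (rule prod_g[of "\<lambda>f l. \<integral>v. f v \<partial>N"]) (simp add: N.prob_space)
  ultimately show ?thesis by simp
qed

text \<open>Under the lowest-index rule a cluster moves with the driver of its lowest member, so for
  a configuration of the coalescing flow this is the index of the Brownian motion currently carrying
  particle \<open>i\<close>.\<close>

definition lead :: "nat \<Rightarrow> (nat \<Rightarrow> real) \<Rightarrow> nat \<Rightarrow> nat" where
  "lead m u i = (LEAST l. l \<in> {1..m} \<and> u l = u i)"

lemma lead:
  assumes "i \<in> {1..m}"
  shows "lead m u i \<in> {1..m}" "u (lead m u i) = u i"
    and "\<And>j. j \<in> {1..m} \<Longrightarrow> j < lead m u i \<Longrightarrow> u j \<noteq> u i"
proof -
  have "\<exists>l. l \<in> {1..m} \<and> u l = u i" using assms by auto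
  from LeastI_ex[OF this] show "lead m u i \<in> {1..m}" "u (lead m u i) = u i"
    by (auto simp: lead_def)
  show "u j \<noteq> u i" if "j \<in> {1..m}" "j < lead m u i" for j
    using not_less_Least[of j "\<lambda>l. l \<in> {1..m} \<and> u l = u i"] that by (auto simp: lead_def)
qed

lemma lead_cong: "u i = u j \<Longrightarrow> lead m u i = lead m u j"
  by (simp add: lead_def)

text \<open>The sign \<open>\<epsilon>\<close> is \<open>1\<close> when the rows carry the moving particles \<open>X\<close> and \<open>-1\<close> for \<open>Y\<close>; the map
  \<open>\<sigma>\<close> selects the particles.\<close>
definition heat_det :: "nat \<Rightarrow> real \<Rightarrow> (nat \<Rightarrow> real) \<Rightarrow> (nat \<Rightarrow> nat) \<Rightarrow> real \<Rightarrow> (nat \<Rightarrow> real) \<Rightarrow> real" where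
  "heat_det k \<epsilon> b \<sigma> s u = shifted_det k (\<lambda>i j. gauss_cdf s (\<epsilon> * (b j - u (\<sigma> i))))"

text \<open>Reduction removes every row that repeats its predecessor. By \<open>contig\<close> a
  cluster occupies consecutive rows, so exactly one row per cluster remains, and different rows read
  different noise coordinates. Each Leibniz product then integrates factor by factor to the
  corresponding product at time \<open>s + h\<close>.\<close>

lemma heat_det_clustered_step:
  assumes s: "0 < s" and h: "0 < h" and \<epsilon>: "\<epsilon> = 1 \<or> \<epsilon> = - 1"
    and \<sigma>: "\<And>i. i < k \<Longrightarrow> \<sigma> i \<in> {1..m}"
    and contig: "\<And>i j. i < j \<Longrightarrow> j < k \<Longrightarrow> u (\<sigma> i) = u (\<sigma> j) \<Longrightarrow> u (\<sigma> (j - 1)) = u (\<sigma> j)"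
  shows "(\<integral>v. heat_det k \<epsilon> b \<sigma> s (\<lambda>i. u i + v (lead m u i)) \<partial>PiM {1..m} (\<lambda>_. gauss h)) =
    heat_det k \<epsilon> b \<sigma> (s + h) u"
proof -
  define NL where "NL = {i. 0 < i \<and> i < k \<and> u (\<sigma> i) = u (\<sigma> (i - 1))}"
  define q where "q i = lead m u (\<sigma> i)" for i
  let ?R = "{0..<k} - NL"
  let ?N = "gauss h"
  let ?P = "PiM {1..m} (\<lambda>_. ?N)"
  interpret N: prob_space ?N by (rule prob_space_gauss[OF h])
  interpret P: prob_space ?P by (intro prob_space_PiM N.prob_space_axioms)
  note [measurable] = borel_measurable_gauss_cdf[OF s]
  define \<phi> where "\<phi> p i v = gauss_cdf s (\<epsilon> * (b (p i) - (u (\<sigma> i) + v))) - of_bool (i < p i)" for p :: "nat \<Rightarrow> nat" and i v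
  define T where "T p v = (\<Prod>i = 0..<k. if i \<in> NL then of_bool (i = p i) else \<phi> p i (v (q i)))" for p v
  have NL: "NL \<subseteq> {0..<k}" by (auto simp: NL_def)
  \<comment> \<open>Two surviving rows with the same lead would lie in one cluster; by
    \<open>contig\<close> the later one would repeat its predecessor and belong to
    \<open>NL\<close>.\<close>
  have qR: "inj_on q ?R" "q ` ?R \<subseteq> {1..m}"
  proof -
    have "False" if ij: "i \<in> ?R" "j \<in> ?R" "q i = q j" "i < j" for i j
    proof -
      have "u (\<sigma> i) = u (\<sigma> j)"
        using lead(2)[OF \<sigma>[of i], of u] lead(2)[OF \<sigma>[of j], of u] ij by (auto simp: q_def)
      then have "u (\<sigma> (j - 1)) = u (\<sigma> j)" using contig[of i j] ij by auto
      then show False using ij by (auto simp: NL_def)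
    qed
    then show "inj_on q ?R" by (metis inj_onI linorder_neqE_nat)
    show "q ` ?R \<subseteq> {1..m}" using lead(1)[OF \<sigma>] by (auto simp: q_def)
  qed
  have \<phi>_bd: "\<bar>\<phi> p i v\<bar> \<le> 1" for p i v
    unfolding \<phi>_def using gauss_cdf_bounds[OF s] by (intro abs_diff_of_bool_le_1) auto
  have \<phi>_m [measurable]: "\<phi> p i \<in> borel_measurable borel" for p i
    unfolding \<phi>_def by measurable
  have \<phi>_i: "integrable ?N (\<phi> p i)" for p i
    by (rule N.integrable_const_bound[where B=1]) (auto simp: \<phi>_bd)
  have \<phi>_int: "(\<integral>v. \<phi> p i v \<partial>?N) = gauss_cdf (s + h) (\<epsilon> * (b (p i) - u (\<sigma> i))) - of_bool (i < p i)" for p i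
  proof -
    have "integrable ?N (\<lambda>v. gauss_cdf s (\<epsilon> * (b (p i) - (u (\<sigma> i) + v))))"
      by (rule N.integrable_const_bound[where B=1]) (use gauss_cdf_bounds[OF s] in auto)
    then show ?thesis
      unfolding \<phi>_def by (subst Bochner_Integration.integral_diff)
        (auto simp: gauss_cdf_martingale[OF s h \<epsilon>] N.prob_space[simplified])
  qed
  have T_eq: "T p v = (\<Prod>i\<in>NL. of_bool (i = p i)) * (\<Prod>i\<in>?R. \<phi> p i (v (q i)))" for p v
  proof -
    have "T p v = (\<Prod>i\<in>{0..<k} \<inter> NL. of_bool (i = p i)) * (\<Prod>i\<in>{0..<k} \<inter> - NL. \<phi> p i (v (q i)))"
      unfolding T_def by (subst prod.If_cases) (auto simp: Collect_mem_eq Collect_neg_eq)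
    moreover have "{0..<k} \<inter> NL = NL" "{0..<k} \<inter> - NL = ?R" using NL by auto
    ultimately show ?thesis by simp
  qed
  have T_int: "(\<integral>v. T p v \<partial>?P) = (\<Prod>i = 0..<k. if i \<in> NL then of_bool (i = p i) else
      gauss_cdf (s + h) (\<epsilon> * (b (p i) - u (\<sigma> i))) - of_bool (i < p i))" for p
  proof -
    have "(\<integral>v. T p v \<partial>?P) = (\<Prod>i\<in>NL. of_bool (i = p i)) * (\<Prod>i\<in>?R. \<integral>v. \<phi> p i v \<partial>?N)"
      unfolding T_eq by (subst integral_mult_right_zero,
        subst integral_PiM_prod_reindex[OF N.prob_space_axioms _ qR \<phi>_i]) auto
    also have "\<dots> = (\<Prod>i\<in>{0..<k} \<inter> NL. of_bool (i = p i)) * (\<Prod>i\<in>{0..<k} \<inter> - NL. \<integral>v. \<phi> p i v \<partial>?N)"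
      using NL by (intro arg_cong2[where f="(*)"] prod.cong) auto
    also have "\<dots> = (\<Prod>i = 0..<k. if i \<in> NL then of_bool (i = p i) else (\<integral>v. \<phi> p i v \<partial>?N))"
      by (subst prod.If_cases) (auto simp: Collect_mem_eq Collect_neg_eq)
    finally show ?thesis by (simp add: \<phi>_int cong: if_cong)
  qed
  have T_m: "T p \<in> borel_measurable ?P" for p
    unfolding T_eq
  proof (intro borel_measurable_times borel_measurable_const borel_measurable_prod)
    fix i assume "i \<in> ?R"
    then have "q i \<in> {1..m}" using qR(2) by blast
    then have "(\<lambda>v. v (q i)) \<in> measurable ?P borel"
      using measurable_component_singleton[of "q i" "{1..m}" "\<lambda>_. ?N"] by simp
    then show "(\<lambda>v. \<phi> p i (v (q i))) \<in> borel_measurable ?P" by measurable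
  qed
  have T_i: "integrable ?P (T p)" for p
  proof (rule P.integrable_const_bound[where B=1])
    show "AE v in ?P. norm (T p v) \<le> 1"
    proof (rule AE_I2)
      fix v show "norm (T p v) \<le> 1"
        unfolding T_def real_norm_def abs_prod by (rule prod_le_1) (auto simp: \<phi>_bd)
    qed
  qed (rule T_m)
  \<comment> \<open>Members of a cluster share their lead and hence their noise, so equal rows are
    still equal after the step and the same set \<open>NL\<close> can be reduced.\<close>
  have "heat_det k \<epsilon> b \<sigma> s (\<lambda>i. u i + v (lead m u i)) =
      (\<Sum>p | p permutes {0..<k}. signof p * T p v)" for v
    unfolding heat_det_def T_def \<phi>_def q_def
    by (subst shifted_det_reduce_leibniz[where NL=NL])
      (auto simp: NL_def lead_def)
  then have "(\<integral>v. heat_det k \<epsilon> b \<sigma> s (\<lambda>i. u i + v (lead m u i)) \<partial>?P) =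
      (\<Sum>p | p permutes {0..<k}. signof p * (\<integral>v. T p v \<partial>?P))"
    by (simp add: T_i[simplified])
  also have "\<dots> = heat_det k \<epsilon> b \<sigma> (s + h) u"
    unfolding heat_det_def T_int
    by (subst shifted_det_reduce_leibniz[where NL=NL]) (auto simp: NL_def)
  finally show ?thesis .
qed

section \<open>Independence of the past\<close>

text \<open>A continuous function on a compact interval attains its infimum, so reaching 0 means
  getting below every 1 / (n + 1), and rational points detect this. Scaling by \<open>s\<close>
  keeps the countable index set independent of \<open>s\<close> and all sampled times in
  [0, s].\<close>

lemma ex_nonpos_iff_rational_approx:
  fixes D :: "real \<Rightarrow> real"
  assumes s: "0 \<le> s" and D: "continuous_on {0..s} D"
  shows "(\<exists>r\<in>{0..s}. D r \<le> 0) \<longleftrightarrow> (\<forall>n::nat. \<exists>q\<in>\<rat> \<inter> {0..1}. D (s * q) < 1 / real (Suc n))"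
proof
  assume "\<exists>r\<in>{0..s}. D r \<le> 0"
  then obtain r where r: "r \<in> {0..s}" "D r \<le> 0" by auto
  \<comment> \<open>For s = 0 the only possible \<open>r\<close> is 0, and any point of [0, 1] would
    do.\<close>
  define a where "a = (if s = 0 then 0 else r / s)"
  have a: "a \<in> {0..1}" "s * a = r" using r s by (auto simp: a_def field_simps)
  show "\<forall>n::nat. \<exists>q\<in>\<rat> \<inter> {0..1}. D (s * q) < 1 / real (Suc n)"
  proof
    fix n
    have ran: "(\<lambda>q. s * q) ` {0..1} \<subseteq> {0..s}" using s by (auto simp: mult_left_le)
    have "continuous_on {0..1} (\<lambda>q. D (s * q))"
      by (rule continuous_on_compose2[OF D _ ran]) (intro continuous_intros)
    from this[unfolded continuous_on_iff, rule_format, OF a(1), of "1 / real (Suc n)"]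
    obtain d where d: "0 < d"
      "\<And>q. q \<in> {0..1} \<Longrightarrow> dist q a < d \<Longrightarrow> dist (D (s * q)) (D (s * a)) < 1 / real (Suc n)"
      by auto
    have "max 0 (a - d) < min 1 (a + d)" using a(1) d(1) by auto
    then obtain q where q: "q \<in> \<rat>" "max 0 (a - d) < q" "q < min 1 (a + d)"
      using Rats_dense_in_real by blast
    then have "dist (D (s * q)) (D (s * a)) < 1 / real (Suc n)"
      by (intro d(2)) (auto simp: dist_real_def)
    then have "D (s * q) < 1 / real (Suc n)" using r(2) a(2) by (auto simp: dist_real_def)
    then show "\<exists>q\<in>\<rat> \<inter> {0..1}. D (s * q) < 1 / real (Suc n)" using q by auto
  qed
next
  assume *: "\<forall>n::nat. \<exists>q\<in>\<rat> \<inter> {0..1}. D (s * q) < 1 / real (Suc n)"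
  show "\<exists>r\<in>{0..s}. D r \<le> 0"
  proof (rule ccontr)
    assume neg: "\<not> ?thesis"
    obtain r0 where r0: "r0 \<in> {0..s}" "\<And>r. r \<in> {0..s} \<Longrightarrow> D r0 \<le> D r"
      using continuous_attains_inf[OF compact_Icc _ D] s by auto
    have "0 < D r0" using neg r0(1) by force
    then obtain n where n: "1 / real (Suc n) < D r0" using nat_approx_posE by blast
    obtain q where "q \<in> {0..1}" "D (s * q) < 1 / real (Suc n)" using * by blast
    moreover from this have "s * q \<in> {0..s}" using s by (auto simp: mult_left_le)
    ultimately show False using r0(2)[of "s * q"] n by auto
  qed
qed

text \<open>Cylinder sets generate the product sigma-algebra, are stable under intersection and
  involve only finitely many coordinates. This carries independence from finitely many past times to
  the uncountably many.\<close>

lemma (in prob_space) indep_var_PiM_finite_subsets: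
  assumes rv: "\<And>i. i \<in> I \<Longrightarrow> Z i \<in> measurable M (N i)"
    and fin: "\<And>K. finite K \<Longrightarrow> K \<subseteq> I \<Longrightarrow> indep_var (PiM K N) (\<lambda>\<omega>. \<lambda>i\<in>K. Z i \<omega>) T V"
  shows "indep_var (PiM I N) (\<lambda>\<omega>. \<lambda>i\<in>I. Z i \<omega>) T V"
proof -
  let ?Z = "\<lambda>\<omega>. \<lambda>i\<in>I. Z i \<omega>"
  have Z: "?Z \<in> measurable M (PiM I N)" using rv by (rule measurable_restrict)
  have V: "V \<in> measurable M T" using fin[of "{}"] by (auto dest: indep_var_rv2)
  let ?A = "{?Z -` A \<inter> space M | A. A \<in> prod_algebra I N}"
  let ?B = "{V -` A \<inter> space M | A. A \<in> sets T}"
  have "indep_set ?A ?B"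
  proof (rule indep_setI)
    show "?A \<subseteq> events"
      using measurable_sets[OF Z] by (auto simp: sets_PiM intro: sigma_sets.Basic)
    show "?B \<subseteq> events" using measurable_sets[OF V] by auto
    fix a b assume "a \<in> ?A" "b \<in> ?B"
    then obtain A B where A: "a = ?Z -` A \<inter> space M" "A \<in> prod_algebra I N"
      and B: "b = V -` B \<inter> space M" "B \<in> sets T" by auto
    from A(2) obtain J E where J: "finite J" "J \<subseteq> I" "E \<in> (\<Pi> i\<in>J. sets (N i))"
      and AE: "A = prod_emb I N J (\<Pi>\<^sub>E j\<in>J. E j)"
      by (auto elim!: prod_algebraE)
    have a: "a = (\<lambda>\<omega>. \<lambda>i\<in>J. Z i \<omega>) -` (\<Pi>\<^sub>E j\<in>J. E j) \<inter> space M"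
      unfolding A(1) AE prod_emb_def using J(2) measurable_space[OF rv]
      by (auto simp: PiE_iff subset_eq)
    have "(\<Pi>\<^sub>E j\<in>J. E j) \<in> sets (PiM J N)" using J by (intro sets_PiM_I_finite) auto
    from indep_varD[OF fin[OF J(1,2)] this B(2)]
    show "prob (a \<inter> b) = prob a * prob b"
      unfolding a B(1) by (simp add: vimage_def Int_def conj_ac cong: conj_cong)
  qed
  moreover have "Int_stable ?A"
  proof (rule Int_stableI)
    fix a b assume "a \<in> ?A" "b \<in> ?A"
    then obtain A B where AB: "a = ?Z -` A \<inter> space M" "A \<in> prod_algebra I N" "b = ?Z -` B \<inter> space M" "B \<in> prod_algebra I N"
      by auto
    then have "A \<inter> B \<in> prod_algebra I N" using Int_stable_prod_algebra by (auto simp: Int_stable_def)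
    then show "a \<inter> b \<in> ?A" using AB by (auto intro!: exI[of _ "A \<inter> B"])
  qed
  moreover have "Int_stable ?B"
  proof (rule Int_stableI)
    fix a b assume "a \<in> ?B" "b \<in> ?B"
    then obtain A B where AB: "a = V -` A \<inter> space M" "A \<in> sets T" "b = V -` B \<inter> space M" "B \<in> sets T"
      by auto
    then show "a \<inter> b \<in> ?B" by (auto intro!: exI[of _ "A \<inter> B"])
  qed
  ultimately have "indep_set (sigma_sets (space M) ?A) (sigma_sets (space M) ?B)"
    by (rule indep_set_sigma_sets)
  moreover have "sigma_sets (space M) {?Z -` A \<inter> space M | A. A \<in> sets (PiM I N)} = sigma_sets (space M) ?A"
  proof -
    have "?Z \<in> space M \<rightarrow> (\<Pi>\<^sub>E i\<in>I. space (N i))"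
      using measurable_space[OF Z] by (auto simp: space_PiM)
    from sigma_sets_vimage_commute[OF this, of "prod_algebra I N"]
    have "{?Z -` A \<inter> space M | A. A \<in> sets (PiM I N)} = sigma_sets (space M) ?A"
      by (simp add: sets_PiM)
    moreover have "?A \<subseteq> Pow (space M)" by auto
    ultimately show ?thesis by (simp add: sigma_sets_sigma_sets_eq)
  qed
  ultimately show ?thesis using Z V by (simp add: indep_var_eq)
qed

lemma (in prob_space) vimage_algebra_sub:
  assumes Z: "Z \<in> measurable M S" and U: "U \<in> measurable (vimage_algebra (space M) Z S) N"
  shows "U \<in> measurable M N"
    and "sigma_sets (space M) {U -` A \<inter> space M | A. A \<in> sets N} \<subseteq>
      sigma_sets (space M) {Z -` A \<inter> space M | A. A \<in> sets S}"
proof -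
  let ?F = "vimage_algebra (space M) Z S"
  have Zs: "Z \<in> space M \<rightarrow> space S" using measurable_space[OF Z] by auto
  have F: "sets ?F = {Z -` A \<inter> space M | A. A \<in> sets S}" by (rule sets_vimage_algebra2[OF Zs])
  have "sets ?F \<subseteq> events" using measurable_sets[OF Z] by (auto simp: F)
  then show "U \<in> measurable M N"
    using U by (auto simp: measurable_def)
  have "{U -` A \<inter> space M | A. A \<in> sets N} \<subseteq> sets ?F"
    using measurable_sets[OF U] by auto
  then have "sigma_sets (space M) {U -` A \<inter> space M | A. A \<in> sets N} \<subseteq> sets ?F"
    using sets.sigma_sets_subset[of _ ?F] by simp
  also have "\<dots> \<subseteq> sigma_sets (space M) {Z -` A \<inter> space M | A. A \<in> sets S}"
    unfolding F by (rule subsetI) (rule sigma_sets.Basic)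
  finally show "sigma_sets (space M) {U -` A \<inter> space M | A. A \<in> sets N} \<subseteq>
      sigma_sets (space M) {Z -` A \<inter> space M | A. A \<in> sets S}" .
qed

text \<open>Measurability with respect to the generated sigma-algebra is all that matters, so the
  position of the flow need not be written as a measurable function of the driving paths.\<close>

lemma (in prob_space) indep_var_vimage_measurable:
  assumes ind: "indep_var S Z T V" and U: "U \<in> measurable (vimage_algebra (space M) Z S) N"
    and U': "U' \<in> measurable (vimage_algebra (space M) V T) N'"
  shows "indep_var N U N' U'"
proof -
  have Z: "Z \<in> measurable M S" and V: "V \<in> measurable M T"
    using ind by (auto dest: indep_var_rv1 indep_var_rv2)
  note subU = vimage_algebra_sub[OF Z U] and subU' = vimage_algebra_sub[OF V U']
  have indZ: "indep_set (sigma_sets (space M) {Z -` A \<inter> space M | A. A \<in> sets S})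
      (sigma_sets (space M) {V -` A \<inter> space M | A. A \<in> sets T})"
    using ind by (simp add: indep_var_eq)
  have "indep_set (sigma_sets (space M) {U -` A \<inter> space M | A. A \<in> sets N})
      (sigma_sets (space M) {U' -` A \<inter> space M | A. A \<in> sets N'})"
  proof (rule indep_setI)
    show "sigma_sets (space M) {U -` A \<inter> space M | A. A \<in> sets N} \<subseteq> events"
      using subU(2) indep_setD_ev1[OF indZ] by (rule order.trans)
    show "sigma_sets (space M) {U' -` A \<inter> space M | A. A \<in> sets N'} \<subseteq> events"
      using subU'(2) indep_setD_ev2[OF indZ] by (rule order.trans)
    fix a b assume a: "a \<in> sigma_sets (space M) {U -` A \<inter> space M | A. A \<in> sets N}"
      and b: "b \<in> sigma_sets (space M) {U' -` A \<inter> space M | A. A \<in> sets N'}"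
    show "prob (a \<inter> b) = prob a * prob b"
      using subsetD[OF subU(2) a] subsetD[OF subU'(2) b] by (rule indep_setD[OF indZ])
  qed
  then show ?thesis using subU(1) subU'(1) by (simp add: indep_var_eq)
qed

section \<open>The flow at a fixed time and the increments of the drivers after it\<close>

locale coalescing_system =
  fixes M :: "'a measure" and m :: nat and W :: "nat \<Rightarrow> real \<Rightarrow> 'a \<Rightarrow> real" and x :: "nat \<Rightarrow> real"
  assumes BM: "indep_std_BMs M m W" and m: "1 \<le> m" and sorted: "\<forall>i\<in>{1..<m}. x i \<le> x (Suc i)"
begin

sublocale prob_space M using BM by (simp add: indep_std_BMs_def)

abbreviation "X \<equiv> coalescing_BM x W"

abbreviation "vecs \<equiv> PiM {1..m} (\<lambda>_. borel :: real measure)"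

lemma W_measurable: "i \<in> {1..m} \<Longrightarrow> 0 \<le> t \<Longrightarrow> W i t \<in> borel_measurable M"
  using BM by (simp add: indep_std_BMs_def)

lemma W_path: "\<omega> \<in> space M \<Longrightarrow> i \<in> {1..m} \<Longrightarrow> continuous_on {0..} (\<lambda>t. W i t \<omega>) \<and> W i 0 \<omega> = 0"
  using BM by (simp add: indep_std_BMs_def)

lemma W_increments:
  assumes ts: "\<forall>l<k. 0 \<le> ts l \<and> ts l < ts (Suc l)"
  shows "indep_vars (\<lambda>_. borel) (\<lambda>(i, l) \<omega>. W i (ts (Suc l)) \<omega> - W i (ts l) \<omega>) ({1..m} \<times> {..<k})"
    and "i \<in> {1..m} \<Longrightarrow> l < k \<Longrightarrow> distributed M lborel (\<lambda>\<omega>. W i (ts (Suc l)) \<omega> - W i (ts l) \<omega>)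
           (normal_density 0 (sqrt (ts (Suc l) - ts l)))"
proof -
  from BM have *: "\<forall>(ts :: nat \<Rightarrow> real) (k :: nat). (\<forall>l<k. 0 \<le> ts l \<and> ts l < ts (Suc l)) \<longrightarrow>
        indep_vars (\<lambda>_. borel) (\<lambda>(i, l) \<omega>. W i (ts (Suc l)) \<omega> - W i (ts l) \<omega>) ({1..m} \<times> {..<k}) \<and>
        (\<forall>i\<in>{1..m}. \<forall>l<k. distributed M lborel (\<lambda>\<omega>. W i (ts (Suc l)) \<omega> - W i (ts l) \<omega>)
           (normal_density 0 (sqrt (ts (Suc l) - ts l))))"
    unfolding indep_std_BMs_def by (elim conjE)
  from *[rule_format, of k ts] ts
  show "indep_vars (\<lambda>_. borel) (\<lambda>(i, l) \<omega>. W i (ts (Suc l)) \<omega> - W i (ts l) \<omega>) ({1..m} \<times> {..<k})"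
    "i \<in> {1..m} \<Longrightarrow> l < k \<Longrightarrow> distributed M lborel (\<lambda>\<omega>. W i (ts (Suc l)) \<omega> - W i (ts l) \<omega>)
           (normal_density 0 (sqrt (ts (Suc l) - ts l)))"
    by blast+
qed

lemma paths:
  assumes "\<omega> \<in> space M"
  shows "coalescing_paths x (\<lambda>k s. W k s \<omega>) m (\<lambda>i t. X i t \<omega>)"
  unfolding coalescing_BM_def
  by (rule coalescing_paths_coal_upto) (use W_path[OF assms] sorted in auto)

text \<open>The position at time \<open>s\<close> depends on the hitting time only through whether
  the driver has reached the left neighbour by then, which is a countable condition on times up to
  \<open>s\<close>. \<open>N\<close> is arbitrary so that it can be \<open>M\<close> or the
  sigma-algebra generated by the past of the drivers.\<close>

lemma X_measurable_past:
  assumes N: "space N = space M"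
    and W: "\<And>j r. j \<in> {1..m} \<Longrightarrow> 0 \<le> r \<Longrightarrow> r \<le> t \<Longrightarrow> W j r \<in> borel_measurable N"
    and s: "0 \<le> s" "s \<le> t" and i: "i \<in> {1..m}"
  shows "X i s \<in> borel_measurable N"
  using i s
proof (induction i arbitrary: s rule: less_induct)
  case (less i)
  show ?case
  proof (cases "1 < i")
    case False
    have "X i s \<in> borel_measurable N \<longleftrightarrow> (\<lambda>\<omega>. x i + W i s \<omega>) \<in> borel_measurable N"
      by (rule measurable_cong)
        (use coalescing_pathsD(5)[OF paths less.prems(1,2)] False N in auto)
    then show ?thesis using W[OF less.prems] by simp
  next
    case True
    then have i: "i - 1 < i" "i - 1 \<in> {1..m}" using less.prems by auto
    define D where "D \<omega> r = x i + W i r \<omega> - X (i - 1) r \<omega>" for \<omega> r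
    have Dc: "continuous_on {0..s} (D \<omega>)" if "\<omega> \<in> space M" for \<omega>
      unfolding D_def
      using continuous_on_subset[OF conjunct1[OF W_path[OF that less.prems(1)]], of "{0..s}"]
        continuous_on_subset[OF coalescing_pathsD(1)[OF paths[OF that] i(2)], of "{0..s}"]
      by (auto intro!: continuous_intros)
    have Dm: "(\<lambda>\<omega>. D \<omega> (s * q)) \<in> borel_measurable N" if "q \<in> {0..1}" for q
    proof -
      have "0 \<le> s * q" "s * q \<le> s" using that less.prems by (auto simp: mult_left_le)
      then have "0 \<le> s * q" "s * q \<le> t" using less.prems by auto
      then show ?thesis unfolding D_def
        using W[OF less.prems(1)] less.IH[OF i] by (intro borel_measurable_diff borel_measurable_add) auto
    qed
    have ev: "Measurable.pred N (\<lambda>\<omega>. \<forall>n::nat. \<exists>q\<in>\<rat> \<inter> {0..1}. D \<omega> (s * q) < 1 / real (Suc n))"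
      unfolding Measurable.pred_def
    proof (intro sets.sets_Collect_countable_All sets.sets_Collect_countable_Ex')
      show "countable (\<rat> \<inter> {0..1::real})" using countable_rat by blast
      show "{\<omega> \<in> space N. D \<omega> (s * q) < 1 / real (Suc n)} \<in> sets N" if "q \<in> \<rat> \<inter> {0..1}" for q n
        using Dm[of q] that by (intro borel_measurable_less) auto
    qed
    have "X i s \<in> borel_measurable N \<longleftrightarrow> (\<lambda>\<omega>. if \<forall>n::nat. \<exists>q\<in>\<rat> \<inter> {0..1}. D \<omega> (s * q) < 1 / real (Suc n)
        then X (i - 1) s \<omega> else x i + W i s \<omega>) \<in> borel_measurable N"
    proof (rule measurable_cong)
      fix \<omega> assume "\<omega> \<in> space N"
      then have \<omega>: "\<omega> \<in> space M" using N by simp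
      show "X i s \<omega> = (if \<forall>n::nat. \<exists>q\<in>\<rat> \<inter> {0..1}. D \<omega> (s * q) < 1 / real (Suc n)
        then X (i - 1) s \<omega> else x i + W i s \<omega>)"
        unfolding ex_nonpos_iff_rational_approx[OF less.prems(2) Dc[OF \<omega>], symmetric]
        using coalescing_pathsD(5)[OF paths[OF \<omega>] less.prems(1,2)] True by (simp add: D_def)
    qed
    moreover have "(\<lambda>\<omega>. if \<forall>n::nat. \<exists>q\<in>\<rat> \<inter> {0..1}. D \<omega> (s * q) < 1 / real (Suc n)
        then X (i - 1) s \<omega> else x i + W i s \<omega>) \<in> borel_measurable N"
      using ev less.IH[OF i less.prems(2,3)] W[OF less.prems] by (intro measurable_If borel_measurable_add) (auto simp: pred_def)
    ultimately show ?thesis by simp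
  qed
qed

lemma X_measurable: "i \<in> {1..m} \<Longrightarrow> 0 \<le> t \<Longrightarrow> X i t \<in> borel_measurable M"
  using X_measurable_past[of M t t i] W_measurable by auto

text \<open>\<open>W i 0\<close> is subtracted because it vanishes only on the space of \<open>M\<close>. The increments are indexed
  by pairs because \<open>indep_var\<close> requires both variables to have the same type.\<close>
lemma indep_finite_past:
  assumes s: "0 \<le> s" "s < t" and K: "finite K" "K \<subseteq> {1..m} \<times> {0..s}"
  shows "indep_var (PiM K (\<lambda>_. borel)) (\<lambda>\<omega>. \<lambda>p\<in>K. W (fst p) (snd p) \<omega> - W (fst p) 0 \<omega>)
      (PiM ({1..m} \<times> {s}) (\<lambda>_. borel)) (\<lambda>\<omega>. \<lambda>p\<in>{1..m} \<times> {s}. W (fst p) t \<omega> - W (fst p) (snd p) \<omega>)"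
proof -
  \<comment> \<open>The grid contains 0, from which past values are summed up, and \<open>s\<close>,
    so that after appending \<open>t\<close> the increment with index \<open>n - 1\<close> is
    exactly the one from \<open>s\<close> to \<open>t\<close>.\<close>
  define S where "S = {0, s} \<union> snd ` K"
  define B where "B = sorted_list_of_set S"
  define n where "n = length B"
  define ts where "ts l = (if l < n then B ! l else t)" for l
  have S: "finite S" "S \<subseteq> {0..s}" using K s by (auto simp: S_def)
  have B: "set B = S" "sorted B" "distinct B" using S by (auto simp: B_def)
  have n: "0 < n" using B by (auto simp: n_def S_def)
  have Bin: "B ! l \<in> {0..s}" if "l < n" for l using B S that nth_mem[of l B] by (auto simp: n_def)
  have idx: "\<exists>l<n. B ! l = r" if "r \<in> S" for r using that B by (auto simp: in_set_conv_nth n_def)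
  have B0: "B ! 0 = 0"
  proof -
    obtain l where l: "l < n" "B ! l = 0" using idx[of 0] by (auto simp: S_def)
    then have "B ! 0 \<le> 0" using sorted_nth_mono[OF B(2), of 0 l] by (simp add: n_def)
    then show ?thesis using Bin[OF n] by simp
  qed
  have Bs: "B ! (n - 1) = s"
  proof -
    obtain l where l: "l < n" "B ! l = s" using idx[of s] by (auto simp: S_def)
    then have "s \<le> B ! (n - 1)" using sorted_nth_mono[OF B(2), of l "n - 1"] by (simp add: n_def)
    then show ?thesis using Bin[of "n - 1"] n by simp
  qed
  have ts: "0 \<le> ts l \<and> ts l < ts (Suc l)" if "l < n" for l
  proof (cases "Suc l < n")
    case True
    have "B ! l \<le> B ! Suc l" using sorted_nth_mono[OF B(2), of l "Suc l"] True by (simp add: n_def)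
    moreover have "B ! l \<noteq> B ! Suc l" using nth_eq_iff_index_eq[OF B(3), of l "Suc l"] True by (simp add: n_def)
    ultimately show ?thesis using Bin[OF that] True by (simp add: ts_def)
  next
    case False
    then show ?thesis using Bin[OF that] that s by (auto simp: ts_def)
  qed
  then have inc: "indep_vars (\<lambda>_. borel) (\<lambda>(i, l) \<omega>. W i (ts (Suc l)) \<omega> - W i (ts l) \<omega>) ({1..m} \<times> {..<n})"
    by (intro W_increments(1)) blast
  define pos where "pos r = (SOME l. l < n \<and> B ! l = r)" for r
  have pos: "pos r < n" "B ! pos r = r" if "r \<in> S" for r
    using someI_ex[of "\<lambda>l. l < n \<and> B ! l = r"] idx[OF that] by (auto simp: pos_def)
  let ?inc = "\<lambda>(i, l) \<omega>. W i (ts (Suc l)) \<omega> - W i (ts l) \<omega>"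
  let ?A1 = "{1..m} \<times> {..<n - 1}" and ?A2 = "{1..m} \<times> {n - 1}"
  \<comment> \<open>Partial sums of the increments telescope to the past values relative to time
    0.\<close>
  define f1 where "f1 z = (\<lambda>p\<in>K. \<Sum>l<pos (snd p). z (fst p, l))" for z :: "nat \<times> nat \<Rightarrow> real"
  define f2 where "f2 z = (\<lambda>p\<in>{1..m} \<times> {s}. z (fst p, n - 1))" for z :: "nat \<times> nat \<Rightarrow> real"
  have "indep_var (PiM ?A1 (\<lambda>_. borel)) (\<lambda>\<omega>. \<lambda>p\<in>?A1. ?inc p \<omega>) (PiM ?A2 (\<lambda>_. borel)) (\<lambda>\<omega>. \<lambda>p\<in>?A2. ?inc p \<omega>)"
    by (rule indep_var_restrict[OF inc]) (use n in auto)
  moreover have "f1 \<in> measurable (PiM ?A1 (\<lambda>_. borel)) (PiM K (\<lambda>_. borel))"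
    unfolding f1_def
  proof (intro measurable_restrict borel_measurable_sum)
    fix p l assume p: "p \<in> K" "l \<in> {..<pos (snd p)}"
    have "snd p \<in> S" using p by (auto simp: S_def)
    then have "(fst p, l) \<in> ?A1" using p K pos(1)[of "snd p"] by auto
    then show "(\<lambda>z. z (fst p, l)) \<in> borel_measurable (PiM ?A1 (\<lambda>_. borel))" by simp
  qed
  moreover have "f2 \<in> measurable (PiM ?A2 (\<lambda>_. borel)) (PiM ({1..m} \<times> {s}) (\<lambda>_. borel))"
    unfolding f2_def by (intro measurable_restrict) auto
  ultimately have "indep_var (PiM K (\<lambda>_. borel)) (f1 \<circ> (\<lambda>\<omega>. \<lambda>p\<in>?A1. ?inc p \<omega>))
      (PiM ({1..m} \<times> {s}) (\<lambda>_. borel)) (f2 \<circ> (\<lambda>\<omega>. \<lambda>p\<in>?A2. ?inc p \<omega>))"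
    by (rule indep_var_compose)
  moreover have "f1 \<circ> (\<lambda>\<omega>. \<lambda>p\<in>?A1. ?inc p \<omega>) = (\<lambda>\<omega>. \<lambda>p\<in>K. W (fst p) (snd p) \<omega> - W (fst p) 0 \<omega>)"
  proof (intro ext)
    fix \<omega> p
    show "(f1 \<circ> (\<lambda>\<omega>. \<lambda>p\<in>?A1. ?inc p \<omega>)) \<omega> p = (\<lambda>p\<in>K. W (fst p) (snd p) \<omega> - W (fst p) 0 \<omega>) p"
    proof (cases "p \<in> K")
      case True
      have r: "snd p \<in> S" using True by (auto simp: S_def)
      have fp: "fst p \<in> {1..m}" using True K(2) by auto
      have "(f1 \<circ> (\<lambda>\<omega>. \<lambda>p\<in>?A1. ?inc p \<omega>)) \<omega> p = (\<Sum>l<pos (snd p). W (fst p) (ts (Suc l)) \<omega> - W (fst p) (ts l) \<omega>)"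
        using True fp pos(1)[OF r] by (auto simp: f1_def intro!: sum.cong)
      also have "\<dots> = W (fst p) (ts (pos (snd p))) \<omega> - W (fst p) (ts 0) \<omega>"
        by (rule sum_lessThan_telescope)
      finally show ?thesis using True pos[OF r] n B0 by (simp add: ts_def)
    qed (simp add: f1_def)
  qed
  moreover have "f2 \<circ> (\<lambda>\<omega>. \<lambda>p\<in>?A2. ?inc p \<omega>) = (\<lambda>\<omega>. \<lambda>p\<in>{1..m} \<times> {s}. W (fst p) t \<omega> - W (fst p) (snd p) \<omega>)"
    using n Bs by (auto simp: f2_def ts_def fun_eq_iff)
  ultimately show ?thesis by simp
qed

text \<open>Stands in for the Markov property at a fixed time: the positions are measurable with
  respect to the past of the drivers, of which the increments after \<open>s\<close> are
  independent.\<close>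

lemma indep_X_increment:
  assumes s: "0 \<le> s" "s < t"
  shows "indep_var vecs (\<lambda>\<omega>. \<lambda>i\<in>{1..m}. X i s \<omega>) vecs (\<lambda>\<omega>. \<lambda>i\<in>{1..m}. W i t \<omega> - W i s \<omega>)"
proof -
  let ?I = "{1..m} \<times> {0..s}"
  let ?Z = "\<lambda>\<omega>. \<lambda>p\<in>?I. W (fst p) (snd p) \<omega> - W (fst p) 0 \<omega>"
  let ?F = "vimage_algebra (space M) ?Z (PiM ?I (\<lambda>_. borel))"
  have rv: "(\<lambda>\<omega>. W (fst p) (snd p) \<omega> - W (fst p) 0 \<omega>) \<in> borel_measurable M" if "p \<in> ?I" for p
    using that by (intro borel_measurable_diff W_measurable) auto
  let ?I' = "{1..m} \<times> {s}"
  let ?V = "\<lambda>\<omega>. \<lambda>p\<in>?I'. W (fst p) t \<omega> - W (fst p) (snd p) \<omega>"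
  let ?G = "vimage_algebra (space M) ?V (PiM ?I' (\<lambda>_. borel))"
  have "indep_var (PiM ?I (\<lambda>_. borel)) ?Z (PiM ?I' (\<lambda>_. borel)) ?V"
    by (rule indep_var_PiM_finite_subsets[OF rv indep_finite_past[OF s]])
  moreover have "(\<lambda>\<omega>. \<lambda>i\<in>{1..m}. X i s \<omega>) \<in> measurable ?F vecs"
  proof (intro measurable_restrict X_measurable_past[where t=s])
    show "space ?F = space M" by simp
    fix j r assume jr: "j \<in> {1..m}" "0 \<le> r" "r \<le> s"
    have "?Z \<in> measurable ?F (PiM ?I (\<lambda>_. borel))"
      by (rule measurable_vimage_algebra1) (auto simp: space_PiM)
    then have "(\<lambda>\<omega>. ?Z \<omega> (j, r)) \<in> borel_measurable ?F"
      by (rule measurable_compose[OF _ measurable_component_singleton]) (use jr in auto)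
    \<comment> \<open>On the space of \<open>M\<close> the drivers start at 0, so coordinate
      \<open>(j, r)\<close> of \<open>?Z\<close> is \<open>W j r\<close> there.\<close>
    moreover have "W j r \<in> borel_measurable ?F \<longleftrightarrow> (\<lambda>\<omega>. ?Z \<omega> (j, r)) \<in> borel_measurable ?F"
      by (rule measurable_cong) (use jr W_path in auto)
    ultimately show "W j r \<in> borel_measurable ?F" by simp
  qed (use s in auto)
  moreover have "(\<lambda>\<omega>. \<lambda>i\<in>{1..m}. W i t \<omega> - W i s \<omega>) \<in> measurable ?G vecs"
  proof (intro measurable_restrict)
    fix i assume i: "i \<in> {1..m}"
    have "?V \<in> measurable ?G (PiM ?I' (\<lambda>_. borel))"
      by (rule measurable_vimage_algebra1) (auto simp: space_PiM)
    then have "(\<lambda>\<omega>. ?V \<omega> (i, s)) \<in> borel_measurable ?G"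
      by (rule measurable_compose[OF _ measurable_component_singleton]) (use i in auto)
    then show "(\<lambda>\<omega>. W i t \<omega> - W i s \<omega>) \<in> borel_measurable ?G" using i by simp
  qed
  ultimately show ?thesis by (rule indep_var_vimage_measurable)
qed

lemma distr_increment:
  assumes s: "0 \<le> s" "s < t"
  shows "distr M vecs (\<lambda>\<omega>. \<lambda>i\<in>{1..m}. W i t \<omega> - W i s \<omega>) = PiM {1..m} (\<lambda>_. gauss (t - s))"
proof -
  define ts where "ts l = (if l = 0 then s else t)" for l :: nat
  have ts: "\<forall>l<1. 0 \<le> ts l \<and> ts l < ts (Suc l)" using s by (simp add: ts_def)
  note inc = W_increments[OF ts]
  have rv: "(\<lambda>\<omega>. W i t \<omega> - W i s \<omega>) \<in> borel_measurable M" if "i \<in> {1..m}" for i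
    using that s by (intro borel_measurable_diff W_measurable) auto
  \<comment> \<open>The pairs are grouped into singleton blocks in order to replace the index
    \<open>(i, 0)\<close> by \<open>i\<close>.\<close>
  have "indep_vars (\<lambda>i. PiM {(i, 0)} (\<lambda>_. borel))
      (\<lambda>i \<omega>. \<lambda>p\<in>{(i, 0)}. (\<lambda>(i, l) \<omega>. W i (ts (Suc l)) \<omega> - W i (ts l) \<omega>) p \<omega>) {1..m}"
    by (rule indep_vars_restrict[OF inc(1)]) (auto simp: disjoint_family_on_def)
  from indep_vars_compose2[OF this, where Y="\<lambda>i z. z (i, 0)" and N="\<lambda>_. borel"]
  have ind: "indep_vars (\<lambda>_. borel) (\<lambda>i \<omega>. W i t \<omega> - W i s \<omega>) {1..m}"
    by (simp add: ts_def)
  have d: "distr M borel (\<lambda>\<omega>. W i t \<omega> - W i s \<omega>) = gauss (t - s)" if "i \<in> {1..m}" for i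
  proof -
    have "distributed M lborel (\<lambda>\<omega>. W i t \<omega> - W i s \<omega>) (normal_density 0 (sqrt (t - s)))"
      using inc(2)[OF that, of 0] by (simp add: ts_def)
    from distributed_distr_eq_density[OF this] show ?thesis
      by (metis distr_cong sets_lborel)
  qed
  have "distr M vecs (\<lambda>\<omega>. \<lambda>i\<in>{1..m}. W i t \<omega> - W i s \<omega>) = (\<Pi>\<^sub>M i\<in>{1..m}. distr M borel (\<lambda>\<omega>. W i t \<omega> - W i s \<omega>))"
    using ind m rv by (subst (asm) indep_vars_iff_distr_eq_PiM') auto
  also have "\<dots> = PiM {1..m} (\<lambda>_. gauss (t - s))" by (rule PiM_cong) (use d in auto)
  finally show ?thesis .
qed

end

section \<open>Expectation of the determinant along the flow\<close>

lemma heat_det_bound: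
  assumes "0 < s"
  shows "\<bar>heat_det k \<epsilon> b \<sigma> s u\<bar> \<le> fact k"
  unfolding heat_det_def by (rule shifted_det_bound) (simp add: gauss_cdf_bounds[OF assms])

lemma heat_det_cong:
  assumes "\<And>i. i < k \<Longrightarrow> u (\<sigma> i) = v (\<sigma> i)"
  shows "heat_det k \<epsilon> b \<sigma> s u = heat_det k \<epsilon> b \<sigma> s v"
  unfolding heat_det_def by (rule shifted_det_cong) (simp add: assms)

lemma heat_det_lipschitz:
  assumes s: "0 < \<delta>" "\<delta> \<le> s" and \<epsilon>: "\<epsilon> = 1 \<or> \<epsilon> = - 1"
    and uv: "\<And>i. i < k \<Longrightarrow> \<bar>u (\<sigma> i) - v (\<sigma> i)\<bar> \<le> e"
  shows "\<bar>heat_det k \<epsilon> b \<sigma> s u - heat_det k \<epsilon> b \<sigma> s v\<bar> \<le> fact k * (real k * (e / sqrt (2 * pi * \<delta>)))"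
  unfolding heat_det_def
proof (rule shifted_det_diff_bound)
  fix i j assume i: "i < k"
  show "0 \<le> gauss_cdf s (\<epsilon> * (b j - u (\<sigma> i))) \<and> gauss_cdf s (\<epsilon> * (b j - u (\<sigma> i))) \<le> 1 \<and>
    0 \<le> gauss_cdf s (\<epsilon> * (b j - v (\<sigma> i))) \<and> gauss_cdf s (\<epsilon> * (b j - v (\<sigma> i))) \<le> 1"
    using gauss_cdf_bounds[of s] s by auto
  have "\<bar>gauss_cdf s (\<epsilon> * (b j - u (\<sigma> i))) - gauss_cdf s (\<epsilon> * (b j - v (\<sigma> i)))\<bar>
      \<le> \<bar>\<epsilon> * (b j - u (\<sigma> i)) - \<epsilon> * (b j - v (\<sigma> i))\<bar> / sqrt (2 * pi * \<delta>)"
    by (rule gauss_cdf_lipschitz[OF s])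
  also have "\<bar>\<epsilon> * (b j - u (\<sigma> i)) - \<epsilon> * (b j - v (\<sigma> i))\<bar> = \<bar>u (\<sigma> i) - v (\<sigma> i)\<bar>"
    using \<epsilon> by (auto simp: abs_minus_commute)
  also have "\<dots> / sqrt (2 * pi * \<delta>) \<le> e / sqrt (2 * pi * \<delta>)"
    using uv[OF i] s by (intro divide_right_mono) auto
  finally show "\<bar>gauss_cdf s (\<epsilon> * (b j - u (\<sigma> i))) - gauss_cdf s (\<epsilon> * (b j - v (\<sigma> i)))\<bar> \<le> e / sqrt (2 * pi * \<delta>)" .
qed

lemma borel_measurable_heat_det:
  assumes s: "0 < s" and u: "\<And>i. i < k \<Longrightarrow> (\<lambda>\<omega>. u \<omega> (\<sigma> i)) \<in> borel_measurable N"
  shows "(\<lambda>\<omega>. heat_det k \<epsilon> b \<sigma> s (u \<omega>)) \<in> borel_measurable N"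
  unfolding heat_det_def
proof (rule borel_measurable_shifted_det)
  fix i j assume "i < k"
  note [measurable] = borel_measurable_gauss_cdf[OF s] u[OF this]
  show "(\<lambda>\<omega>. gauss_cdf s (\<epsilon> * (b j - u \<omega> (\<sigma> i)))) \<in> borel_measurable N" by measurable
qed

text \<open>The lowest member of each cluster. The cardinality is the number of clusters and acts as
  a potential that drops with every merger.\<close>

definition leaders :: "nat \<Rightarrow> (nat \<Rightarrow> real) \<Rightarrow> nat set" where
  "leaders m u = {k \<in> {1..m}. \<forall>j\<in>{1..m}. j < k \<longrightarrow> u j \<noteq> u k}"

text \<open>The clusters present at time \<open>s\<close> are carried on by their drivers up to
  \<open>t\<close>, ignoring any meeting in between; they may pass through one another.\<close>

definition free_step :: "nat \<Rightarrow> (nat \<Rightarrow> real \<Rightarrow> real) \<Rightarrow> (nat \<Rightarrow> real \<Rightarrow> real) \<Rightarrow> real \<Rightarrow> real \<Rightarrow> nat \<Rightarrow> real" where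
  "free_step m w P s t i =
     P i s + (w (lead m (\<lambda>j. P j s) i) t - w (lead m (\<lambda>j. P j s) i) s)"

lemma leaders_antimono:
  assumes P: "coalescing_paths x w m P" and st: "0 \<le> s" "s \<le> t"
  shows "leaders m (\<lambda>j. P j t) \<subseteq> leaders m (\<lambda>j. P j s)"
proof
  fix k assume k: "k \<in> leaders m (\<lambda>j. P j t)"
  then have k1: "k \<in> {1..m}" by (simp add: leaders_def)
  have "P j s \<noteq> P k s" if j: "j \<in> {1..m}" "j < k" for j
    using coalescing_pathsD(4)[OF P j(1) k1 st] j k by (auto simp: leaders_def)
  then show "k \<in> leaders m (\<lambda>j. P j s)" using k1 by (simp add: leaders_def)
qed

text \<open>A leader at both times sits on its own driver at both times, so its displacement is the
  driver's increment; its cluster moves along with it.\<close>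

lemma free_step_eq:
  assumes P: "coalescing_paths x w m P" and st: "0 \<le> s" "s \<le> t"
    and L: "leaders m (\<lambda>j. P j s) \<subseteq> leaders m (\<lambda>j. P j t)" and i: "i \<in> {1..m}"
  shows "free_step m w P s t i = P i t"
proof -
  define l where "l = lead m (\<lambda>j. P j s) i"
  have l: "l \<in> {1..m}" "P l s = P i s" "\<And>j. j \<in> {1..m} \<Longrightarrow> j < l \<Longrightarrow> P j s \<noteq> P i s"
    using lead[OF i, where u="\<lambda>j. P j s"] by (auto simp: l_def)
  have ls: "l \<in> leaders m (\<lambda>j. P j s)" using l by (simp add: leaders_def)
  then have lt: "l \<in> leaders m (\<lambda>j. P j t)" using L by blast
  have "P l s = x l + w l s"
    by (rule coalescing_paths_driver[OF P l(1) st(1)]) (use ls in \<open>auto simp: leaders_def\<close>)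
  moreover have "P l t = x l + w l t"
    by (rule coalescing_paths_driver[OF P l(1)]) (use lt st in \<open>auto simp: leaders_def\<close>)
  moreover have "P l t = P i t" by (rule coalescing_pathsD(4)[OF P l(1) i st l(2)])
  ultimately show ?thesis using l(2) by (simp add: free_step_def l_def)
qed

text \<open>A step contributes an error only if it loses a leader, so over a whole partition at most
  \<open>m\<close> steps contribute.\<close>
lemma free_step_error:
  assumes P: "coalescing_paths x w m P" and st: "0 \<le> s" "s \<le> t"
    and \<sigma>: "\<And>i. i < k \<Longrightarrow> \<sigma> i \<in> {1..m}"
    and B: "\<bar>heat_det k \<epsilon> b \<sigma> r (\<lambda>i. P i t) - heat_det k \<epsilon> b \<sigma> r (free_step m w P s t)\<bar> \<le> B"
  shows "\<bar>heat_det k \<epsilon> b \<sigma> r (\<lambda>i. P i t) - heat_det k \<epsilon> b \<sigma> r (free_step m w P s t)\<bar> \<le>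
    (real (card (leaders m (\<lambda>j. P j s))) - real (card (leaders m (\<lambda>j. P j t)))) * B"
proof (cases "leaders m (\<lambda>j. P j s) = leaders m (\<lambda>j. P j t)")
  case True
  have "heat_det k \<epsilon> b \<sigma> r (\<lambda>i. P i t) = heat_det k \<epsilon> b \<sigma> r (free_step m w P s t)"
    by (rule heat_det_cong) (use free_step_eq[OF P st] True \<sigma> in auto)
  then show ?thesis using True by simp
next
  case False
  then have "leaders m (\<lambda>j. P j t) \<subset> leaders m (\<lambda>j. P j s)"
    using leaders_antimono[OF P st] by auto
  then have "card (leaders m (\<lambda>j. P j t)) < card (leaders m (\<lambda>j. P j s))"
    by (intro psubset_card_mono) (auto simp: leaders_def)
  then have 1: "1 \<le> real (card (leaders m (\<lambda>j. P j s))) - real (card (leaders m (\<lambda>j. P j t)))"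
    by linarith
  have "0 \<le> B" using B by linarith
  then have "1 * B \<le> (real (card (leaders m (\<lambda>j. P j s))) - real (card (leaders m (\<lambda>j. P j t)))) * B"
    using 1 by (intro mult_right_mono)
  then show ?thesis using B by linarith
qed

lemma sum_free_step_error:
  assumes P: "coalescing_paths x w m P" and ts: "\<And>l. l < n \<Longrightarrow> 0 \<le> ts l \<and> ts l \<le> ts (Suc l)"
    and \<sigma>: "\<And>i. i < k \<Longrightarrow> \<sigma> i \<in> {1..m}"
    and B: "\<And>l. l < n \<Longrightarrow> \<bar>heat_det k \<epsilon> b \<sigma> (r l) (\<lambda>i. P i (ts (Suc l))) -
      heat_det k \<epsilon> b \<sigma> (r l) (free_step m w P (ts l) (ts (Suc l)))\<bar> \<le> B"
    and B0: "0 \<le> B"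
  shows "(\<Sum>l<n. \<bar>heat_det k \<epsilon> b \<sigma> (r l) (\<lambda>i. P i (ts (Suc l))) -
      heat_det k \<epsilon> b \<sigma> (r l) (free_step m w P (ts l) (ts (Suc l)))\<bar>) \<le> real m * B"
proof -
  let ?c = "\<lambda>l. real (card (leaders m (\<lambda>j. P j (ts l))))"
  have "(\<Sum>l<n. \<bar>heat_det k \<epsilon> b \<sigma> (r l) (\<lambda>i. P i (ts (Suc l))) -
      heat_det k \<epsilon> b \<sigma> (r l) (free_step m w P (ts l) (ts (Suc l)))\<bar>) \<le> (\<Sum>l<n. (?c l - ?c (Suc l)) * B)"
    by (intro sum_mono free_step_error[OF P _ _ \<sigma> B]) (use ts in auto)
  also have "\<dots> = (?c 0 - ?c n) * B"
    using sum_lessThan_telescope'[of ?c n] by (simp add: sum_distrib_right[symmetric])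
  also have "\<dots> \<le> real m * B"
  proof (rule mult_right_mono[OF _ B0])
    have "card (leaders m (\<lambda>j. P j (ts 0))) \<le> card {1..m}"
      by (rule card_mono) (auto simp: leaders_def)
    then show "?c 0 - ?c n \<le> real m" by simp
  qed
  finally show ?thesis .
qed

lemma lead_restrict:
  assumes "i \<in> {1..m}"
  shows "lead m (restrict u {1..m}) i = lead m u i"
  unfolding lead_def by (rule arg_cong[where f=Least]) (use assms in auto)

lemma measurable_lead:
  assumes i: "i \<in> {1..m}"
  shows "(\<lambda>u. lead m u i) \<in> measurable (PiM {1..m} (\<lambda>_. borel :: real measure)) (count_space UNIV)"
  unfolding lead_def
proof (rule measurable_Least)
  fix l
  show "Measurable.pred (PiM {1..m} (\<lambda>_. borel)) (\<lambda>u. l \<in> {1..m} \<and> u l = (u i :: real))"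
  proof (cases "l \<in> {1..m}")
    case True
    have ui: "(\<lambda>u. u l) \<in> borel_measurable (PiM {1..m} (\<lambda>_. borel :: real measure))"
      "(\<lambda>u. u i) \<in> borel_measurable (PiM {1..m} (\<lambda>_. borel :: real measure))"
      using True i by (auto intro!: measurable_component_singleton)
    show ?thesis unfolding Measurable.pred_def using borel_measurable_eq[OF ui] True by simp
  next
    case False
    show ?thesis unfolding Measurable.pred_def by (simp only: False simp_thms Collect_conv_if) simp
  qed
qed

context coalescing_system
begin

lemma X_sorted: "\<omega> \<in> space M \<Longrightarrow> i \<in> {1..m} \<Longrightarrow> j \<in> {1..m} \<Longrightarrow> i \<le> j \<Longrightarrow> 0 \<le> t \<Longrightarrow> X i t \<omega> \<le> X j t \<omega>"
  by (rule coalescing_pathsD(3)[OF paths])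

abbreviation "free s t \<omega> \<equiv> free_step m (\<lambda>k s. W k s \<omega>) (\<lambda>i t. X i t \<omega>) s t"

lemma free_measurable:
  assumes s: "0 \<le> s" "s < t" and i: "i \<in> {1..m}"
  shows "(\<lambda>\<omega>. free s t \<omega> i) \<in> borel_measurable M"
proof -
  have U: "(\<lambda>\<omega>. \<lambda>j\<in>{1..m}. X j s \<omega>) \<in> measurable M vecs"
    using s by (intro measurable_restrict X_measurable) auto
  have "(\<lambda>\<omega>. lead m (\<lambda>j\<in>{1..m}. X j s \<omega>) i) \<in> measurable M (count_space UNIV)"
    using measurable_compose[OF U measurable_lead[OF i]] .
  then have l: "(\<lambda>\<omega>. lead m (\<lambda>j. X j s \<omega>) i) \<in> measurable M (count_space UNIV)"
    using lead_restrict[OF i] by simp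
  \<comment> \<open>The random index is resolved into a finite sum over its possible values, which
    makes measurability visible.\<close>
  have eq: "free s t \<omega> i = X i s \<omega> + (\<Sum>l\<in>{1..m}. if lead m (\<lambda>j. X j s \<omega>) i = l then W l t \<omega> - W l s \<omega> else 0)" for \<omega>
    using lead(1)[OF i, of "\<lambda>j. X j s \<omega>"] by (simp add: free_step_def)
  show ?thesis
    unfolding eq
  proof (intro borel_measurable_add borel_measurable_sum measurable_If borel_measurable_diff)
    fix l
    show "{\<omega> \<in> space M. lead m (\<lambda>j. X j s \<omega>) i = l} \<in> sets M"
      using l by measurable
  qed (use s i in \<open>auto intro: X_measurable W_measurable\<close>)
qed

text \<open>By independence the configuration at time \<open>s\<close> can be frozen while the
  Gaussian increments are integrated out, which is the one-step identity. \<open>\<sigma>\<close>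
  may run in either direction because the reflected problem numbers the particles backwards.\<close>

lemma expectation_free_step:
  assumes s: "0 \<le> s" "s < t" and r: "0 < r" and \<epsilon>: "\<epsilon> = 1 \<or> \<epsilon> = - 1"
    and \<sigma>: "\<And>i. i < k \<Longrightarrow> \<sigma> i \<in> {1..m}"
    and mono: "(\<forall>i j. i \<le> j \<longrightarrow> j < k \<longrightarrow> \<sigma> i \<le> \<sigma> j) \<or> (\<forall>i j. i \<le> j \<longrightarrow> j < k \<longrightarrow> \<sigma> j \<le> \<sigma> i)"
  shows "expectation (\<lambda>\<omega>. heat_det k \<epsilon> b \<sigma> r (free s t \<omega>)) =
    expectation (\<lambda>\<omega>. heat_det k \<epsilon> b \<sigma> (r + (t - s)) (\<lambda>i. X i s \<omega>))"
proof -
  let ?G = "PiM {1..m} (\<lambda>_. gauss (t - s))"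
  define U where "U \<omega> = (\<lambda>i\<in>{1..m}. X i s \<omega>)" for \<omega>
  define V where "V \<omega> = (\<lambda>i\<in>{1..m}. W i t \<omega> - W i s \<omega>)" for \<omega>
  have ind: "indep_var vecs U vecs V"
    unfolding U_def[abs_def] V_def[abs_def] by (rule indep_X_increment[OF s])
  have U [measurable]: "U \<in> measurable M vecs" and V [measurable]: "V \<in> measurable M vecs"
    using ind by (auto dest: indep_var_rv1 indep_var_rv2)
  have dV: "distr M vecs V = ?G" unfolding V_def[abs_def] by (rule distr_increment[OF s])
  have joint: "distr M (vecs \<Otimes>\<^sub>M vecs) (\<lambda>\<omega>. (U \<omega>, V \<omega>)) = distr M vecs U \<Otimes>\<^sub>M ?G"
    using ind unfolding indep_var_distribution_eq dV by (elim conjE) (rule sym)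
  interpret DU: prob_space "distr M vecs U" by (rule prob_space_distr[OF U])
  interpret G: prob_space ?G unfolding dV[symmetric] by (rule prob_space_distr[OF V])
  interpret Q: pair_prob_space "distr M vecs U" ?G by unfold_locales
  define \<Psi> where "\<Psi> = (\<lambda>(u, v). heat_det k \<epsilon> b \<sigma> r (\<lambda>i. u i + v (lead m u i)))"
  have \<Psi>m: "\<Psi> \<in> borel_measurable (vecs \<Otimes>\<^sub>M vecs)"
    unfolding \<Psi>_def split_beta
  proof (rule borel_measurable_heat_det[OF r])
    fix i assume "i < k"
    then have i: "\<sigma> i \<in> {1..m}" by (rule \<sigma>)
    have l: "(\<lambda>p. lead m (fst p) (\<sigma> i)) \<in> measurable (vecs \<Otimes>\<^sub>M vecs) (count_space UNIV)"
      by (rule measurable_compose[OF measurable_fst measurable_lead[OF i]])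
    have eq: "(snd p :: nat \<Rightarrow> real) (lead m (fst p) (\<sigma> i)) =
        (\<Sum>l\<in>{1..m}. if lead m (fst p) (\<sigma> i) = l then snd p l else 0)" for p :: "(nat \<Rightarrow> real) \<times> (nat \<Rightarrow> real)"
      using lead(1)[OF i, of "fst p"] by simp
    show "(\<lambda>p. fst p (\<sigma> i) + snd p (lead m (fst p) (\<sigma> i))) \<in> borel_measurable (vecs \<Otimes>\<^sub>M vecs)"
      unfolding eq
    proof (intro borel_measurable_add borel_measurable_sum measurable_If borel_measurable_const)
      show "(\<lambda>p. fst p (\<sigma> i)) \<in> borel_measurable (vecs \<Otimes>\<^sub>M vecs)"
        by (rule measurable_compose[OF measurable_fst measurable_component_singleton[OF i]])
      fix l assume "l \<in> {1..m}"
      then show "(\<lambda>p. snd p l) \<in> borel_measurable (vecs \<Otimes>\<^sub>M vecs)"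
        by (rule measurable_compose[OF measurable_snd measurable_component_singleton])
      show "{p \<in> space (vecs \<Otimes>\<^sub>M vecs). lead m (fst p) (\<sigma> i) = l} \<in> sets (vecs \<Otimes>\<^sub>M vecs)"
        using l by measurable
    qed
  qed
  have sets_eq: "sets (distr M vecs U \<Otimes>\<^sub>M ?G) = sets (vecs \<Otimes>\<^sub>M vecs)"
    unfolding joint[symmetric] by simp
  have \<Psi>m': "\<Psi> \<in> borel_measurable (distr M vecs U \<Otimes>\<^sub>M ?G)"
    using \<Psi>m by (simp add: measurable_cong_sets[OF sets_eq refl])
  have \<Psi>i: "integrable (distr M vecs U \<Otimes>\<^sub>M ?G) \<Psi>"
    by (rule Q.P.integrable_const_bound[where B="fact k", OF AE_I2 \<Psi>m'])
      (auto simp: \<Psi>_def split_beta heat_det_bound[OF r])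
  have free: "heat_det k \<epsilon> b \<sigma> r (free s t \<omega>) = \<Psi> (U \<omega>, V \<omega>)" for \<omega>
    unfolding \<Psi>_def split
  proof (rule heat_det_cong)
    fix i assume "i < k"
    then have i: "\<sigma> i \<in> {1..m}" by (rule \<sigma>)
    show "free s t \<omega> (\<sigma> i) = U \<omega> (\<sigma> i) + V \<omega> (lead m (U \<omega>) (\<sigma> i))"
      using i lead(1)[OF i, of "\<lambda>j. X j s \<omega>"] lead_restrict[OF i, of "\<lambda>j. X j s \<omega>"]
      by (simp add: free_step_def U_def V_def)
  qed
  have "expectation (\<lambda>\<omega>. heat_det k \<epsilon> b \<sigma> r (free s t \<omega>)) =
      (\<integral>p. \<Psi> p \<partial>distr M (vecs \<Otimes>\<^sub>M vecs) (\<lambda>\<omega>. (U \<omega>, V \<omega>)))"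
    unfolding free by (rule integral_distr[symmetric, OF measurable_Pair[OF U V] \<Psi>m])
  also have "\<dots> = (\<integral>u. (\<integral>v. \<Psi> (u, v) \<partial>?G) \<partial>distr M vecs U)"
    unfolding joint using \<Psi>i by (rule Q.integral_fst'[symmetric])
  also have "\<dots> = expectation (\<lambda>\<omega>. \<integral>v. \<Psi> (U \<omega>, v) \<partial>?G)"
  proof (rule integral_distr[OF U])
    have "(\<lambda>u. \<integral>v. \<Psi> (u, v) \<partial>?G) \<in> borel_measurable (distr M vecs U)"
      by (rule G.borel_measurable_lebesgue_integral) (use \<Psi>m' in \<open>simp only: case_prod_Pair_iden case_prod_eta\<close>)
    then show "(\<lambda>u. \<integral>v. \<Psi> (u, v) \<partial>?G) \<in> borel_measurable vecs" by (simp only: measurable_distr_eq1)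
  qed
  also have "\<dots> = expectation (\<lambda>\<omega>. heat_det k \<epsilon> b \<sigma> (r + (t - s)) (\<lambda>i. X i s \<omega>))"
  proof (rule Bochner_Integration.integral_cong[OF refl])
    fix \<omega> assume \<omega>: "\<omega> \<in> space M"
    \<comment> \<open>As \<open>\<sigma>\<close> is monotone, particle
      \<open>\<sigma> (j - 1)\<close> lies between \<open>\<sigma> i\<close> and
      \<open>\<sigma> j\<close> in the order of the flow and is squeezed when these two
      coincide.\<close>
    have contig: "U \<omega> (\<sigma> (j - 1)) = U \<omega> (\<sigma> j)" if ij: "i < j" "j < k" "U \<omega> (\<sigma> i) = U \<omega> (\<sigma> j)" for i j
    proof -
      have idx: "\<sigma> i \<in> {1..m}" "\<sigma> (j - 1) \<in> {1..m}" "\<sigma> j \<in> {1..m}" using \<sigma>[of i] \<sigma>[of "j - 1"] \<sigma>[of j] ij by linarith+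
      note srt = X_sorted[OF \<omega> _ _ _ s(1)]
      have "(\<sigma> i \<le> \<sigma> (j - 1) \<and> \<sigma> (j - 1) \<le> \<sigma> j) \<or> (\<sigma> j \<le> \<sigma> (j - 1) \<and> \<sigma> (j - 1) \<le> \<sigma> i)"
      proof -
        have le: "i \<le> j - 1" "j - 1 \<le> j" "j - 1 < k" using ij by auto
        from mono show ?thesis
        proof
          assume "\<forall>i j. i \<le> j \<longrightarrow> j < k \<longrightarrow> \<sigma> i \<le> \<sigma> j"
          then show ?thesis using le ij(2) by blast
        next
          assume "\<forall>i j. i \<le> j \<longrightarrow> j < k \<longrightarrow> \<sigma> j \<le> \<sigma> i"
          then show ?thesis using le ij(2) by blast
        qed
      qed
      then show ?thesis
        using srt[OF idx(1,2)] srt[OF idx(2,3)] srt[OF idx(3,2)] srt[OF idx(2,1)] ij(3) idx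
        unfolding U_def by (elim disjE conjE) simp_all
    qed
    have "(\<integral>v. \<Psi> (U \<omega>, v) \<partial>?G) = heat_det k \<epsilon> b \<sigma> (r + (t - s)) (U \<omega>)"
      unfolding \<Psi>_def split
    proof (rule heat_det_clustered_step[OF r _ \<epsilon>])
      show "0 < t - s" using s by simp
      show "\<sigma> i \<in> {1..m}" if "i < k" for i using that by (rule \<sigma>)
      show "U \<omega> (\<sigma> (j - 1)) = U \<omega> (\<sigma> j)" if "i < j" "j < k" "U \<omega> (\<sigma> i) = U \<omega> (\<sigma> j)" for i j
        using that by (rule contig)
    qed
    also have "\<dots> = heat_det k \<epsilon> b \<sigma> (r + (t - s)) (\<lambda>i. X i s \<omega>)"
      by (rule heat_det_cong) (simp only: U_def restrict_apply' \<sigma>)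
    finally show "(\<integral>v. \<Psi> (U \<omega>, v) \<partial>?G) = heat_det k \<epsilon> b \<sigma> (r + (t - s)) (\<lambda>i. X i s \<omega>)" .
  qed
  finally show ?thesis .
qed

end

section \<open>Vanishing of the merging error as the mesh tends to zero\<close>

lemma eventually_uniform_increment_less:
  fixes f :: "real \<Rightarrow> real"
  assumes f: "continuous_on {0..T} f" and \<eta>: "0 < \<eta>"
  shows "\<forall>\<^sub>F N in sequentially. \<forall>s\<in>{0..T}. \<forall>t\<in>{0..T}. \<bar>t - s\<bar> \<le> T / real (Suc N) \<longrightarrow> \<bar>f t - f s\<bar> < \<eta>"
proof -
  have "uniformly_continuous_on {0..T} f" using f by (rule compact_uniformly_continuous) simp
  then obtain d where d: "0 < d" "\<And>s t. s \<in> {0..T} \<Longrightarrow> t \<in> {0..T} \<Longrightarrow> dist t s < d \<Longrightarrow> dist (f t) (f s) < \<eta>"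
    unfolding uniformly_continuous_on_def using \<eta> by blast
  have "(\<lambda>N. T / real (Suc N)) \<longlonglongrightarrow> 0" using LIMSEQ_Suc[OF lim_const_over_n[of T]] .
  then have "\<forall>\<^sub>F N in sequentially. T / real (Suc N) < d" using d(1) by (rule order_tendstoD)
  then show ?thesis
  proof (rule eventually_mono, intro ballI impI)
    fix N s t assume N: "T / real (Suc N) < d" and st: "s \<in> {0..T}" "t \<in> {0..T}" "\<bar>t - s\<bar> \<le> T / real (Suc N)"
    have "dist t s < d" using N st(3) by (simp add: dist_real_def)
    then show "\<bar>f t - f s\<bar> < \<eta>" using d(2)[OF st(1,2)] by (simp add: dist_real_def)
  qed
qed

context coalescing_system
begin

lemma heat_det_integrable:
  assumes "0 < s" and "\<And>i. i < k \<Longrightarrow> (\<lambda>\<omega>. u \<omega> (\<sigma> i)) \<in> borel_measurable M"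
  shows "integrable M (\<lambda>\<omega>. heat_det k \<epsilon> b \<sigma> s (u \<omega>))"
proof (rule integrable_const_bound[where B="fact k"])
  show "AE \<omega> in M. norm (heat_det k \<epsilon> b \<sigma> s (u \<omega>)) \<le> fact k"
    by (simp add: heat_det_bound[OF assms(1)])
  show "(\<lambda>\<omega>. heat_det k \<epsilon> b \<sigma> s (u \<omega>)) \<in> borel_measurable M"
    using assms by (rule borel_measurable_heat_det)
qed

text \<open>Elapsed time plus kernel time is always \<delta> + T along the partition. The
  expectation changes in a step only by the difference between true and free motion. Pathwise the
  sum of these differences is at most \<open>m\<close> times the largest one, which tends to 0 by
  uniform continuity; as the determinants are bounded, dominated convergence applies.\<close>

lemma expectation_heat_det_smooth:
  assumes T: "0 < T" and \<delta>: "0 < \<delta>" and \<epsilon>: "\<epsilon> = 1 \<or> \<epsilon> = - 1"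
    and \<sigma>: "\<And>i. i < k \<Longrightarrow> \<sigma> i \<in> {1..m}"
    and mono: "(\<forall>i j. i \<le> j \<longrightarrow> j < k \<longrightarrow> \<sigma> i \<le> \<sigma> j) \<or> (\<forall>i j. i \<le> j \<longrightarrow> j < k \<longrightarrow> \<sigma> j \<le> \<sigma> i)"
  shows "expectation (\<lambda>\<omega>. heat_det k \<epsilon> b \<sigma> \<delta> (\<lambda>i. X i T \<omega>)) = heat_det k \<epsilon> b \<sigma> (\<delta> + T) x"
proof -
  define ts where "ts N l = real l * (T / real (Suc N))" for N l :: nat
  define r where "r N l = \<delta> + T - ts N (Suc l)" for N l
  \<comment> \<open>Interpolates between the determinant at the starting points,
    \<open>l = 0\<close>, and the expectation at time \<open>T\<close>,
    \<open>l = Suc N\<close>.\<close>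
  define a where "a N l = expectation (\<lambda>\<omega>. heat_det k \<epsilon> b \<sigma> (\<delta> + T - ts N l) (\<lambda>i. X i (ts N l) \<omega>))" for N l
  define A where "A N l \<omega> = heat_det k \<epsilon> b \<sigma> (r N l) (\<lambda>i. X i (ts N (Suc l)) \<omega>)" for N l \<omega>
  define F where "F N l \<omega> = heat_det k \<epsilon> b \<sigma> (r N l) (free (ts N l) (ts N (Suc l)) \<omega>)" for N l \<omega>
  define S where "S N \<omega> = (\<Sum>l<Suc N. \<bar>A N l \<omega> - F N l \<omega>\<bar>)" for N \<omega>
  have ts_step: "ts N (Suc l) - ts N l = T / real (Suc N)" for N l
    by (simp add: ts_def algebra_simps add_divide_distrib)
  have ts_less: "ts N l < ts N (Suc l)" for N l
  proof -
    have "0 < T / real (Suc N)" using T by simp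
    then show ?thesis using ts_step[of N l] by linarith
  qed
  have ts_nonneg: "0 \<le> ts N l" for N l
    using T by (simp add: ts_def)
  have ts_le: "ts N l \<le> T" if "l \<le> Suc N" for N l
  proof -
    have "ts N l \<le> real (Suc N) * (T / real (Suc N))"
      unfolding ts_def using that T by (intro mult_right_mono) (auto simp del: of_nat_Suc)
    then show ?thesis by simp
  qed
  have r: "\<delta> \<le> r N l" "0 < r N l" if "l < Suc N" for N l
    using ts_le[of "Suc l" N] that \<delta> by (auto simp: r_def)
  have AI: "integrable M (A N l)" if "l < Suc N" for N l
    unfolding A_def[abs_def]
    by (rule heat_det_integrable[OF r(2)[OF that]]) (rule X_measurable[OF \<sigma> ts_nonneg])
  have FI: "integrable M (F N l)" if "l < Suc N" for N l
    unfolding F_def[abs_def]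
    by (rule heat_det_integrable[OF r(2)[OF that]]) (rule free_measurable[OF ts_nonneg ts_less \<sigma>])
  have EF: "expectation (F N l) = a N l" if "l < Suc N" for N l
  proof -
    have "expectation (F N l) = expectation (\<lambda>\<omega>. heat_det k \<epsilon> b \<sigma> (r N l + (ts N (Suc l) - ts N l)) (\<lambda>i. X i (ts N l) \<omega>))"
      unfolding F_def[abs_def]
      by (rule expectation_free_step[OF ts_nonneg ts_less r(2)[OF that] \<epsilon> _ mono]) (rule \<sigma>)
    moreover have "r N l + (ts N (Suc l) - ts N l) = \<delta> + T - ts N l" by (simp add: r_def)
    ultimately show ?thesis by (simp add: a_def)
  qed
  have EA: "expectation (A N l) = a N (Suc l)" for N l by (simp add: A_def[abs_def] a_def r_def)
  have bound: "\<bar>a N (Suc N) - a N 0\<bar> \<le> expectation (S N)" for N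
  proof -
    have "a N (Suc N) - a N 0 = (\<Sum>l<Suc N. a N (Suc l) - a N l)" by (rule sum_lessThan_telescope[symmetric])
    also have "\<dots> = (\<Sum>l<Suc N. expectation (\<lambda>\<omega>. A N l \<omega> - F N l \<omega>))"
      by (rule sum.cong[OF refl]) (simp add: AI FI EA EF del: of_nat_Suc)
    finally have "\<bar>a N (Suc N) - a N 0\<bar> \<le> (\<Sum>l<Suc N. \<bar>expectation (\<lambda>\<omega>. A N l \<omega> - F N l \<omega>)\<bar>)"
      by (metis sum_abs)
    also have "\<dots> \<le> (\<Sum>l<Suc N. expectation (\<lambda>\<omega>. \<bar>A N l \<omega> - F N l \<omega>\<bar>))"
      by (intro sum_mono integral_abs_bound)
    also have "\<dots> = expectation (S N)"
      unfolding S_def[abs_def]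
      by (subst Bochner_Integration.integral_sum) (auto intro!: integrable_abs Bochner_Integration.integrable_diff AI FI)
    finally show ?thesis .
  qed
  \<comment> \<open>Used with a small \<open>B\<close> for convergence and with
    \<open>B = 2 * fact k\<close> for domination.\<close>
  have SN: "S N \<omega> \<le> real m * B" if \<omega>: "\<omega> \<in> space M" and B0: "0 \<le> B"
    and B: "\<And>l. l < Suc N \<Longrightarrow> \<bar>A N l \<omega> - F N l \<omega>\<bar> \<le> B" for N \<omega> B
    unfolding S_def A_def F_def
  proof (rule sum_free_step_error[OF paths[OF \<omega>] _ _ _ B0])
    show "0 \<le> ts N l \<and> ts N l \<le> ts N (Suc l)" for l using ts_nonneg ts_less[of N l] by auto
    show "\<sigma> i \<in> {1..m}" if "i < k" for i using that by (rule \<sigma>)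
    show "\<bar>heat_det k \<epsilon> b \<sigma> (r N l) (\<lambda>i. X i (ts N (Suc l)) \<omega>) -
        heat_det k \<epsilon> b \<sigma> (r N l) (free (ts N l) (ts N (Suc l)) \<omega>)\<bar> \<le> B" if "l < Suc N" for l
      using B[OF that] by (simp add: A_def F_def)
  qed
  have S_nonneg: "0 \<le> S N \<omega>" for N \<omega> by (simp add: S_def sum_nonneg)
  \<comment> \<open>The Lipschitz constant of the determinant at kernel times from
    \<open>\<delta>\<close> on. The factor 2 arises because during a step both the true particle and
    the driver of its free copy move by less than \<open>\<eta>\<close>.\<close>
  define C where "C = fact k * (real k * (2 / sqrt (2 * pi * \<delta>)))"
  have C0: "0 \<le> C" using \<delta> by (simp add: C_def)
  have small: "\<forall>\<^sub>F N in sequentially. S N \<omega> \<le> real m * (C * \<eta>)" if \<omega>: "\<omega> \<in> space M" and \<eta>: "0 < \<eta>" for \<omega> \<eta>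
  proof -
    have sub: "{0..T} \<subseteq> {0..}" by auto
    have "\<forall>\<^sub>F N in sequentially. \<forall>i\<in>{1..m}.
        (\<forall>s\<in>{0..T}. \<forall>t\<in>{0..T}. \<bar>t - s\<bar> \<le> T / real (Suc N) \<longrightarrow> \<bar>X i t \<omega> - X i s \<omega>\<bar> < \<eta>) \<and>
        (\<forall>s\<in>{0..T}. \<forall>t\<in>{0..T}. \<bar>t - s\<bar> \<le> T / real (Suc N) \<longrightarrow> \<bar>W i t \<omega> - W i s \<omega>\<bar> < \<eta>)"
    proof (rule eventually_ball_finite[OF _ ballI[OF eventually_conj]])
      fix i assume i: "i \<in> {1..m}"
      show "\<forall>\<^sub>F N in sequentially. \<forall>s\<in>{0..T}. \<forall>t\<in>{0..T}. \<bar>t - s\<bar> \<le> T / real (Suc N) \<longrightarrow> \<bar>X i t \<omega> - X i s \<omega>\<bar> < \<eta>"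
        by (rule eventually_uniform_increment_less[OF continuous_on_subset[OF coalescing_pathsD(1)[OF paths[OF \<omega>] i] sub] \<eta>])
      show "\<forall>\<^sub>F N in sequentially. \<forall>s\<in>{0..T}. \<forall>t\<in>{0..T}. \<bar>t - s\<bar> \<le> T / real (Suc N) \<longrightarrow> \<bar>W i t \<omega> - W i s \<omega>\<bar> < \<eta>"
        by (rule eventually_uniform_increment_less[OF continuous_on_subset[OF conjunct1[OF W_path[OF \<omega> i]] sub] \<eta>])
    qed simp
    then show ?thesis
    proof (rule eventually_mono)
      fix N
      assume N: "\<forall>i\<in>{1..m}.
        (\<forall>s\<in>{0..T}. \<forall>t\<in>{0..T}. \<bar>t - s\<bar> \<le> T / real (Suc N) \<longrightarrow> \<bar>X i t \<omega> - X i s \<omega>\<bar> < \<eta>) \<and>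
        (\<forall>s\<in>{0..T}. \<forall>t\<in>{0..T}. \<bar>t - s\<bar> \<le> T / real (Suc N) \<longrightarrow> \<bar>W i t \<omega> - W i s \<omega>\<bar> < \<eta>)"
      show "S N \<omega> \<le> real m * (C * \<eta>)"
      proof (rule SN[OF \<omega>])
        show "0 \<le> C * \<eta>" using C0 \<eta> by simp
        fix l assume l: "l < Suc N"
        let ?s = "ts N l" and ?t = "ts N (Suc l)"
        have st: "?s \<in> {0..T}" "?t \<in> {0..T}" "\<bar>?t - ?s\<bar> \<le> T / real (Suc N)"
          using ts_nonneg ts_le[of l N] ts_le[of "Suc l" N] l T by (auto simp: ts_step simp del: of_nat_Suc)
        have diff: "\<bar>X i ?t \<omega> - free ?s ?t \<omega> i\<bar> \<le> 2 * \<eta>" if i: "i \<in> {1..m}" for i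
        proof -
          define j where "j = lead m (\<lambda>j. X j ?s \<omega>) i"
          have j: "j \<in> {1..m}" unfolding j_def by (rule lead(1)[OF i])
          have "\<bar>X i ?t \<omega> - X i ?s \<omega>\<bar> < \<eta>" "\<bar>W j ?t \<omega> - W j ?s \<omega>\<bar> < \<eta>"
            using N i j st by blast+
          then show ?thesis by (simp add: free_step_def j_def)
        qed
        have "\<bar>A N l \<omega> - F N l \<omega>\<bar> \<le> fact k * (real k * (2 * \<eta> / sqrt (2 * pi * \<delta>)))"
          unfolding A_def F_def
          by (rule heat_det_lipschitz[OF \<delta> r(1)[OF l] \<epsilon>]) (rule diff[OF \<sigma>])
        also have "\<dots> = C * \<eta>" by (simp add: C_def)
        finally show "\<bar>A N l \<omega> - F N l \<omega>\<bar> \<le> C * \<eta>" .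
      qed
    qed
  qed
  have lim: "(\<lambda>N. S N \<omega>) \<longlonglongrightarrow> 0" if \<omega>: "\<omega> \<in> space M" for \<omega>
  proof (rule order_tendstoI)
    show "\<forall>\<^sub>F N in sequentially. c < S N \<omega>" if "c < 0" for c
      using that S_nonneg by (auto intro!: always_eventually intro: less_le_trans)
    fix c :: real assume c: "0 < c"
    \<comment> \<open>The added 1 keeps the denominator positive when \<open>C\<close> = 0 and makes
      the resulting bound strictly smaller than \<open>c\<close>.\<close>
    have pos: "0 < real m * C + 1" using C0 by (simp add: add_nonneg_pos)
    have "\<forall>\<^sub>F N in sequentially. S N \<omega> \<le> real m * (C * (c / (real m * C + 1)))"
      by (rule small[OF \<omega>]) (use c pos in simp)
    then show "\<forall>\<^sub>F N in sequentially. S N \<omega> < c"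
    proof (rule eventually_mono)
      fix N assume N: "S N \<omega> \<le> real m * (C * (c / (real m * C + 1)))"
      have "real m * (C * (c / (real m * C + 1))) < c"
        using pos c by (simp add: field_simps)
      with N show "S N \<omega> < c" by simp
    qed
  qed
  have S_bd: "S N \<omega> \<le> real m * (2 * fact k)" if \<omega>: "\<omega> \<in> space M" for N \<omega>
  proof (rule SN[OF \<omega>])
    fix l assume l: "l < Suc N"
    have "\<bar>A N l \<omega>\<bar> \<le> fact k" "\<bar>F N l \<omega>\<bar> \<le> fact k"
      unfolding A_def F_def by (rule heat_det_bound[OF r(2)[OF l]])+
    then show "\<bar>A N l \<omega> - F N l \<omega>\<bar> \<le> 2 * fact k" by linarith
  qed simp
  have "(\<lambda>N. expectation (S N)) \<longlonglongrightarrow> expectation (\<lambda>_. 0)"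
  proof (rule integral_dominated_convergence[where w="\<lambda>_. real m * (2 * fact k)"])
    show "S N \<in> borel_measurable M" for N
      unfolding S_def[abs_def]
      by (intro borel_measurable_sum borel_measurable_abs borel_measurable_diff borel_measurable_integrable)
        (use AI FI in auto)
    show "AE \<omega> in M. (\<lambda>N. S N \<omega>) \<longlonglongrightarrow> 0" using lim by (rule AE_I2)
    show "AE \<omega> in M. norm (S N \<omega>) \<le> real m * (2 * fact k)" for N
      using S_bd S_nonneg by (intro AE_I2) simp
  qed simp_all
  then have ES: "(\<lambda>N. expectation (S N)) \<longlonglongrightarrow> 0" by simp
  have aT: "a N (Suc N) = expectation (\<lambda>\<omega>. heat_det k \<epsilon> b \<sigma> \<delta> (\<lambda>i. X i T \<omega>))" for N
  proof -
    have "ts N (Suc N) = T" by (simp add: ts_def del: of_nat_Suc)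
    then show ?thesis by (simp add: a_def)
  qed
  have a0: "a N 0 = heat_det k \<epsilon> b \<sigma> (\<delta> + T) x" for N
  proof -
    have "a N 0 = expectation (\<lambda>\<omega>. heat_det k \<epsilon> b \<sigma> (\<delta> + T) x)"
      unfolding a_def
    proof (rule Bochner_Integration.integral_cong[OF refl])
      fix \<omega> assume "\<omega> \<in> space M"
      note X0 = coalescing_pathsD(2)[OF paths[OF this]]
      have "ts N 0 = 0" by (simp add: ts_def)
      then show "heat_det k \<epsilon> b \<sigma> (\<delta> + T - ts N 0) (\<lambda>i. X i (ts N 0) \<omega>) = heat_det k \<epsilon> b \<sigma> (\<delta> + T) x"
        by (simp only: diff_zero) (rule heat_det_cong, rule X0[OF \<sigma>])
    qed
    then show ?thesis by (simp add: prob_space)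
  qed
  have "\<bar>expectation (\<lambda>\<omega>. heat_det k \<epsilon> b \<sigma> \<delta> (\<lambda>i. X i T \<omega>)) - heat_det k \<epsilon> b \<sigma> (\<delta> + T) x\<bar> \<le> 0"
    by (rule LIMSEQ_le_const[OF ES]) (use bound in \<open>simp add: aT a0\<close>)
  then show ?thesis by simp
qed

section \<open>Passage to the terminal time\<close>

lemma AE_driver_neq:
  assumes i: "i \<in> {1..m}" and T: "0 < T"
  shows "AE \<omega> in M. x i + W i T \<omega> \<noteq> c"
proof -
  define ts where "ts l = (if l = 0 then 0 else T)" for l :: nat
  have "\<forall>l<1. 0 \<le> ts l \<and> ts l < ts (Suc l)" using T by (simp add: ts_def)
  from W_increments(2)[OF this i, of 0]
  have D: "distributed M lborel (\<lambda>\<omega>. W i T \<omega> - W i 0 \<omega>) (normal_density 0 (sqrt T))"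
    by (simp add: ts_def)
  let ?Z = "(\<lambda>\<omega>. W i T \<omega> - W i 0 \<omega>) -` {c - x i} \<inter> space M"
  have "emeasure M ?Z = (\<integral>\<^sup>+z. ennreal (normal_density 0 (sqrt T) z) * indicator {c - x i} z \<partial>lborel)"
    by (rule distributed_emeasure[OF D]) simp
  also have "\<dots> = (\<integral>\<^sup>+z. 0 \<partial>(lborel :: real measure))"
  proof (rule nn_integral_cong_AE)
    show "AE z in lborel. ennreal (normal_density 0 (sqrt T) z) * indicator {c - x i} z = 0"
      using AE_lborel_singleton[of "c - x i"] by eventually_elim (simp add: indicator_def)
  qed
  finally have "emeasure M ?Z = 0" by simp
  moreover have "?Z \<in> sets M"
    using distributed_measurable[OF D] by (auto intro!: measurable_sets)
  ultimately have "?Z \<in> null_sets M" by auto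
  then show ?thesis
    by (rule AE_I') (use W_path i in auto)
qed

text \<open>Keeps the shrinking kernels off the jump of the limiting indicator. The position is one
  of finitely many Gaussian variables, each of which avoids \<open>c\<close> almost surely.\<close>

lemma AE_X_neq:
  assumes i: "i \<in> {1..m}" and T: "0 < T"
  shows "AE \<omega> in M. X i T \<omega> \<noteq> c"
proof -
  have "AE \<omega> in M. \<forall>j\<in>{1..m}. x j + W j T \<omega> \<noteq> c"
    by (rule AE_finite_allI) (use AE_driver_neq[OF _ T] in auto)
  with AE_space show ?thesis
  proof eventually_elim
    case (elim \<omega>)
    then show ?case using coalescing_paths_range[OF paths[OF elim(1)] i, of T] T by force
  qed
qed

text \<open>The flow is observed at time T - \<delta> with kernel time \<delta>, so the total time
  is \<open>T\<close> and the value on the right does not change with \<delta>. As \<delta> tends to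
  0, path continuity and the absence of atoms turn the kernels into indicators, almost surely and
  boundedly.\<close>

lemma expectation_shifted_det:
  assumes T: "0 < T" and \<epsilon>: "\<epsilon> = 1 \<or> \<epsilon> = - 1"
    and \<sigma>: "\<And>i. i < k \<Longrightarrow> \<sigma> i \<in> {1..m}"
    and mono: "(\<forall>i j. i \<le> j \<longrightarrow> j < k \<longrightarrow> \<sigma> i \<le> \<sigma> j) \<or> (\<forall>i j. i \<le> j \<longrightarrow> j < k \<longrightarrow> \<sigma> j \<le> \<sigma> i)"
  shows "expectation (\<lambda>\<omega>. shifted_det k (\<lambda>i j. of_bool (0 \<le> \<epsilon> * (b j - X (\<sigma> i) T \<omega>)))) = heat_det k \<epsilon> b \<sigma> T x"
proof -
  \<comment> \<open>Starting at T / 2 leaves the observation time \<open>T - \<delta> n\<close>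
    positive for every \<open>n\<close>.\<close>
  define \<delta> where "\<delta> n = T / real (Suc (Suc n))" for n
  have \<delta>: "0 < \<delta> n" "\<delta> n < T" for n using T by (auto simp: \<delta>_def divide_less_eq)
  have \<delta>0: "\<delta> \<longlonglongrightarrow> 0" unfolding \<delta>_def[abs_def]
    using LIMSEQ_Suc[OF LIMSEQ_Suc[OF lim_const_over_n[of T]]] .
  let ?f = "\<lambda>\<omega>. shifted_det k (\<lambda>i j. of_bool (0 \<le> \<epsilon> * (b j - X (\<sigma> i) T \<omega>)))"
  let ?s = "\<lambda>n \<omega>. heat_det k \<epsilon> b \<sigma> (\<delta> n) (\<lambda>i. X i (T - \<delta> n) \<omega>)"
  have "(\<lambda>n. expectation (?s n)) \<longlonglongrightarrow> expectation ?f"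
  proof (rule integral_dominated_convergence[where w="\<lambda>_. fact k"])
    show "?f \<in> borel_measurable M"
    proof (rule borel_measurable_shifted_det)
      fix i j assume "i < k"
      have [measurable]: "X (\<sigma> i) T \<in> borel_measurable M"
        using \<sigma>[OF \<open>i < k\<close>] T by (intro X_measurable) auto
      show "(\<lambda>\<omega>. of_bool (0 \<le> \<epsilon> * (b j - X (\<sigma> i) T \<omega>)) :: real) \<in> borel_measurable M"
        unfolding of_bool_def by measurable
    qed
    show "?s n \<in> borel_measurable M" for n
    proof (rule borel_measurable_heat_det[OF \<delta>(1)])
      show "X (\<sigma> i) (T - \<delta> n) \<in> borel_measurable M" if "i < k" for i
        by (rule X_measurable[OF \<sigma>[OF that]]) (use \<delta>(2)[of n] in simp)
    qed
    show "AE \<omega> in M. norm (?s n \<omega>) \<le> fact k" for n by (simp add: heat_det_bound[OF \<delta>(1)])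
    have "AE \<omega> in M. \<forall>i\<in>{..<k}. \<forall>j\<in>{..<k}. X (\<sigma> i) T \<omega> \<noteq> b j"
      by (intro AE_finite_allI AE_X_neq[OF _ T]) (use \<sigma> in auto)
    with AE_space show "AE \<omega> in M. (\<lambda>n. ?s n \<omega>) \<longlonglongrightarrow> ?f \<omega>"
    proof eventually_elim
      case (elim \<omega>)
      show ?case
        unfolding heat_det_def
      proof (rule tendsto_shifted_det)
        fix i j assume ij: "i < k" "j < k"
        have "(\<lambda>n. X (\<sigma> i) (T - \<delta> n) \<omega>) \<longlonglongrightarrow> X (\<sigma> i) T \<omega>"
        proof (rule continuous_on_tendsto_compose[OF coalescing_pathsD(1)[OF paths[OF elim(1)] \<sigma>[OF ij(1)]]])
          show "(\<lambda>n. T - \<delta> n) \<longlonglongrightarrow> T" using tendsto_diff[OF tendsto_const \<delta>0, of T] by simp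
          show "T \<in> {0..}" using T by simp
          show "\<forall>\<^sub>F n in sequentially. T - \<delta> n \<in> {0..}"
            using \<delta>(2) by (intro always_eventually allI) (simp add: less_imp_le)
        qed
        then have lim: "(\<lambda>n. \<epsilon> * (b j - X (\<sigma> i) (T - \<delta> n) \<omega>)) \<longlonglongrightarrow> \<epsilon> * (b j - X (\<sigma> i) T \<omega>)"
          by (intro tendsto_intros)
        have "X (\<sigma> i) T \<omega> \<noteq> b j" using elim(2) ij by blast
        then have "\<epsilon> * (b j - X (\<sigma> i) T \<omega>) \<noteq> 0" using \<epsilon> by auto
        then show "(\<lambda>n. gauss_cdf (\<delta> n) (\<epsilon> * (b j - X (\<sigma> i) (T - \<delta> n) \<omega>))) \<longlonglongrightarrow> of_bool (0 \<le> \<epsilon> * (b j - X (\<sigma> i) T \<omega>))"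
          by (rule tendsto_gauss_cdf_0[OF \<delta>(1) \<delta>0 lim])
      qed
    qed
  qed simp
  moreover have "expectation (?s n) = heat_det k \<epsilon> b \<sigma> T x" for n
    using expectation_heat_det_smooth[of "T - \<delta> n" "\<delta> n" \<epsilon> k \<sigma> b, OF _ \<delta>(1) \<epsilon> \<sigma> mono] \<delta>(2)[of n] by simp
  ultimately have "(\<lambda>n. heat_det k \<epsilon> b \<sigma> T x) \<longlonglongrightarrow> expectation ?f" by simp
  then show ?thesis by (simp add: LIMSEQ_const_iff)
qed

end

section \<open>Duality\<close>

lemma (in prob_space) expectation_of_bool:
  assumes "{\<omega> \<in> space M. Q \<omega>} \<in> sets M"
  shows "expectation (\<lambda>\<omega>. of_bool (Q \<omega>) :: real) = prob {\<omega> \<in> space M. Q \<omega>}"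
proof -
  have "expectation (\<lambda>\<omega>. of_bool (Q \<omega>) :: real) = expectation (indicator {\<omega> \<in> space M. Q \<omega>})"
    by (rule Bochner_Integration.integral_cong) (auto simp: indicator_def)
  then show ?thesis using assms by simp
qed

context coalescing_system
begin

text \<open>The particles and the bounds \<open>c\<close> are both sorted, so the indicator matrix
  is monotone and its determinant is the indicator of the event. Matrix rows count from 0 and
  particles from 1, whence \<open>Suc\<close> in the role of \<open>\<sigma>\<close>.\<close>

lemma prob_X_all_le:
  assumes T: "0 < T" and k: "k \<le> m" and c: "\<And>i j. i \<le> j \<Longrightarrow> j < k \<Longrightarrow> c i \<le> c j"
  shows "prob {\<omega> \<in> space M. \<forall>i<k. X (Suc i) T \<omega> \<le> c i} =
    shifted_det k (\<lambda>i j. gauss_cdf T (c j - x (Suc i)))"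
proof -
  have idx: "Suc i \<in> {1..m}" if "i < k" for i using that k by auto
  have [measurable]: "X (Suc i) T \<in> borel_measurable M" if "i < k" for i
    using idx[OF that] T by (intro X_measurable) auto
  have ev: "{\<omega> \<in> space M. \<forall>i\<in>{..<k}. X (Suc i) T \<omega> \<le> c i} \<in> sets M"
    by (rule sets.sets_Collect_finite_All) (auto intro: borel_measurable_le)
  have "shifted_det k (\<lambda>i j. of_bool (0 \<le> 1 * (c j - X (Suc i) T \<omega>))) = of_bool (\<forall>i<k. X (Suc i) T \<omega> \<le> c i)"
    if \<omega>: "\<omega> \<in> space M" for \<omega>
  proof -
    have "shifted_det k (\<lambda>i j. of_bool (X (Suc i) T \<omega> \<le> c j)) = of_bool (\<forall>i<k. X (Suc i) T \<omega> \<le> c i)"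
    proof (rule shifted_det_indicator)
      fix i j i' j' assume a: "X (Suc i) T \<omega> \<le> c j" "i' \<le> i" "j \<le> j'" "i < k" "j' < k"
      have "X (Suc i') T \<omega> \<le> X (Suc i) T \<omega>"
        by (rule X_sorted[OF \<omega> idx idx]) (use a T in auto)
      then show "X (Suc i') T \<omega> \<le> c j'" using a(1) c[OF a(3,5)] by linarith
    qed
    then show ?thesis by simp
  qed
  then have "prob {\<omega> \<in> space M. \<forall>i<k. X (Suc i) T \<omega> \<le> c i} =
      expectation (\<lambda>\<omega>. shifted_det k (\<lambda>i j. of_bool (0 \<le> 1 * (c j - X (Suc i) T \<omega>))))"
    using ev by (subst expectation_of_bool[symmetric])
      (auto simp: Ball_def intro!: Bochner_Integration.integral_cong)
  also have "\<dots> = heat_det k 1 c Suc T x"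
    by (rule expectation_shifted_det[OF T]) (use idx in auto)
  finally show ?thesis by (simp add: heat_det_def)
qed

text \<open>Here the particles belong to the columns. Reflection in the antidiagonal turns them into
  rows with reversed numbering and sign \<open>\<epsilon>\<close> = -1, to which the row formula
  applies; a second reflection restores the original order. \<open>\<tau>\<close> may repeat a
  particle.\<close>

lemma prob_X_all_ge:
  assumes T: "0 < T" and \<tau>: "\<And>i. i < k \<Longrightarrow> \<tau> i \<in> {1..m}"
    and \<tau>_mono: "\<And>i j. i \<le> j \<Longrightarrow> j < k \<Longrightarrow> \<tau> i \<le> \<tau> j"
    and c: "\<And>i j. i \<le> j \<Longrightarrow> j < k \<Longrightarrow> c i \<le> c j"
  shows "prob {\<omega> \<in> space M. \<forall>i<k. c i \<le> X (\<tau> i) T \<omega>} =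
    shifted_det k (\<lambda>i j. gauss_cdf T (x (\<tau> j) - c i))"
proof -
  let ?\<sigma> = "\<lambda>i. \<tau> (k - 1 - i)" and ?b = "\<lambda>j. c (k - 1 - j)"
  have [measurable]: "X (\<tau> i) T \<in> borel_measurable M" if "i < k" for i
    using \<tau>[OF that] T by (intro X_measurable) auto
  have ev: "{\<omega> \<in> space M. \<forall>i\<in>{..<k}. c i \<le> X (\<tau> i) T \<omega>} \<in> sets M"
    by (rule sets.sets_Collect_finite_All) (auto intro: borel_measurable_le)
  have "shifted_det k (\<lambda>i j. of_bool (0 \<le> - 1 * (?b j - X (?\<sigma> i) T \<omega>))) = of_bool (\<forall>i<k. c i \<le> X (\<tau> i) T \<omega>)"
    if \<omega>: "\<omega> \<in> space M" for \<omega>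
  proof -
    have "shifted_det k (\<lambda>i j. of_bool (c i \<le> X (\<tau> j) T \<omega>)) = of_bool (\<forall>i<k. c i \<le> X (\<tau> i) T \<omega>)"
    proof (rule shifted_det_indicator)
      fix i j i' j' assume a: "c i \<le> X (\<tau> j) T \<omega>" "i' \<le> i" "j \<le> j'" "i < k" "j' < k"
      have "X (\<tau> j) T \<omega> \<le> X (\<tau> j') T \<omega>"
        by (rule X_sorted[OF \<omega> \<tau> \<tau> \<tau>_mono]) (use a T in auto)
      then show "c i' \<le> X (\<tau> j') T \<omega>" using a(1) c[OF a(2,4)] by linarith
    qed
    then show ?thesis
      using shifted_det_flip[of k "\<lambda>i j. of_bool (c i \<le> X (\<tau> j) T \<omega>)"] by simp
  qed
  then have "prob {\<omega> \<in> space M. \<forall>i<k. c i \<le> X (\<tau> i) T \<omega>} =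
      expectation (\<lambda>\<omega>. shifted_det k (\<lambda>i j. of_bool (0 \<le> - 1 * (?b j - X (?\<sigma> i) T \<omega>))))"
    using ev by (subst expectation_of_bool[symmetric])
      (auto simp: Ball_def intro!: Bochner_Integration.integral_cong)
  also have "\<dots> = heat_det k (- 1) ?b ?\<sigma> T x"
  proof (rule expectation_shifted_det[OF T])
    show "?\<sigma> i \<in> {1..m}" if "i < k" for i by (rule \<tau>) (use that in simp)
    have "?\<sigma> j \<le> ?\<sigma> i" if "i \<le> j" "j < k" for i j
      by (rule \<tau>_mono) (use that in auto)
    then show "(\<forall>i j. i \<le> j \<longrightarrow> j < k \<longrightarrow> ?\<sigma> i \<le> ?\<sigma> j) \<or> (\<forall>i j. i \<le> j \<longrightarrow> j < k \<longrightarrow> ?\<sigma> j \<le> ?\<sigma> i)"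
      by blast
  qed simp
  also have "\<dots> = shifted_det k (\<lambda>i j. gauss_cdf T (x (\<tau> j) - c i))"
    unfolding heat_det_def
    by (subst (2) shifted_det_flip) (simp add: algebra_simps)
  finally show ?thesis .
qed

end

text \<open>A condition at (i', j) with i' \<ge> i implies the one at (i, j). So the strongest
  demand on row \<open>i\<close> is the smallest column that \<open>S\<close> contains in any row
  from \<open>i\<close> on, and this minimum is nondecreasing in \<open>i\<close>. Beyond the last
  row \<open>k\<close> occurring in \<open>S\<close> nothing is demanded.\<close>

lemma monotone_relation_staircase:
  fixes S :: "(nat \<times> nat) set"
  assumes S: "S \<subseteq> {1..m} \<times> {1..n}"
  obtains k \<tau> where "k \<le> m" "\<And>i. i < k \<Longrightarrow> \<tau> i \<in> {1..n}" "\<And>i j. i \<le> j \<Longrightarrow> j < k \<Longrightarrow> \<tau> i \<le> \<tau> j"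
    and "\<And>C. (\<And>i j i' j'. C i j \<Longrightarrow> i' \<le> i \<Longrightarrow> j \<le> j' \<Longrightarrow> i \<in> {1..m} \<Longrightarrow> i' \<in> {1..m} \<Longrightarrow>
          j \<in> {1..n} \<Longrightarrow> j' \<in> {1..n} \<Longrightarrow> C i' j') \<Longrightarrow>
        (\<forall>(i, j)\<in>S. C i j) \<longleftrightarrow> (\<forall>i<k. C (Suc i) (\<tau> i))"
proof -
  have finS: "finite S" using S by (rule finite_subset) simp
  \<comment> \<open>For empty \<open>S\<close> the value 0 makes the right-hand side vacuous. Rows
    count from 1 and the steps of the staircase from 0, hence \<open>Suc i\<close> in the next
    definition.\<close>
  define k where "k = (if S = {} then 0 else Max (fst ` S))"
  define J where "J i = {j. \<exists>i'. (i', j) \<in> S \<and> Suc i \<le> i'}" for i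
  define \<tau> where "\<tau> i = Min (J i)" for i
  have JS: "J i \<subseteq> snd ` S" for i by (force simp: J_def)
  then have finJ: "finite (J i)" for i using finS by (meson finite_imageI finite_subset)
  have km: "k \<le> m" using S finS by (auto simp: k_def)
  have Jne: "J i \<noteq> {}" if "i < k" for i
  proof -
    have "S \<noteq> {}" using that by (auto simp: k_def split: if_splits)
    then have "k \<in> fst ` S" using finS by (simp add: k_def)
    then show ?thesis using that by (force simp: J_def)
  qed
  have \<tau>J: "\<tau> i \<in> J i" if "i < k" for i unfolding \<tau>_def using finJ Jne[OF that] by (rule Min_in)
  have \<tau>n: "\<tau> i \<in> {1..n}" if "i < k" for i using \<tau>J[OF that] S by (auto simp: J_def)
  have \<tau>mono: "\<tau> i \<le> \<tau> j" if "i \<le> j" "j < k" for i j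
    unfolding \<tau>_def by (rule Min_antimono) (use that Jne finJ in \<open>auto simp: J_def\<close>)
  show thesis
  proof (rule that[OF km \<tau>n \<tau>mono])
    fix C :: "nat \<Rightarrow> nat \<Rightarrow> bool"
    assume mono: "\<And>i j i' j'. C i j \<Longrightarrow> i' \<le> i \<Longrightarrow> j \<le> j' \<Longrightarrow> i \<in> {1..m} \<Longrightarrow> i' \<in> {1..m} \<Longrightarrow>
          j \<in> {1..n} \<Longrightarrow> j' \<in> {1..n} \<Longrightarrow> C i' j'"
    show "(\<forall>(i, j)\<in>S. C i j) \<longleftrightarrow> (\<forall>i<k. C (Suc i) (\<tau> i))"
    proof (intro iffI allI impI)
      fix i assume C: "\<forall>(i, j)\<in>S. C i j" and i: "i < k"
      from \<tau>J[OF i] obtain i' where i': "(i', \<tau> i) \<in> S" "Suc i \<le> i'" by (auto simp: J_def)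
      show "C (Suc i) (\<tau> i)"
        by (rule mono[of i' "\<tau> i"]) (use C i' S i km in auto)
    next
      assume C: "\<forall>i<k. C (Suc i) (\<tau> i)"
      have "C i j" if ij: "(i, j) \<in> S" for i j
      proof -
        have i: "i \<in> {1..m}" "j \<in> {1..n}" using ij S by auto
        have "i \<le> k" using ij finS by (force simp: k_def intro!: Max_ge)
        then have ik: "i - 1 < k" "Suc (i - 1) = i" using i by auto
        have "j \<in> J (i - 1)" using ij ik(2) by (auto simp: J_def)
        then have "\<tau> (i - 1) \<le> j" unfolding \<tau>_def using finJ by (intro Min_le)
        moreover have "C i (\<tau> (i - 1))" using C[rule_format, OF ik(1)] ik(2) by simp
        ultimately show ?thesis using mono[of i "\<tau> (i - 1)" i j] i \<tau>n[OF ik(1)] by blast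
      qed
      then show "\<forall>(i, j)\<in>S. C i j" by blast
    qed
  qed
qed

text \<open>The event that \<open>R\<close> contains \<open>S\<close> splits disjointly according to
  the exact value of \<open>R\<close>. Solving for the value \<open>S\<close> gives
  inclusion-exclusion in recursive form.\<close>

lemma random_set_singleton_events:
  assumes "prob_space M" and I: "finite I" and R: "\<And>\<omega>. \<omega> \<in> space M \<Longrightarrow> R \<omega> \<subseteq> I"
    and ev: "\<And>S. S \<subseteq> I \<Longrightarrow> {\<omega> \<in> space M. S \<subseteq> R \<omega>} \<in> sets M"
    and S: "S \<subseteq> I"
  shows "{\<omega> \<in> space M. R \<omega> = S} \<in> sets M"
    and "measure M {\<omega> \<in> space M. R \<omega> = S} =
      measure M {\<omega> \<in> space M. S \<subseteq> R \<omega>} - (\<Sum>S' | S \<subset> S' \<and> S' \<subseteq> I. measure M {\<omega> \<in> space M. R \<omega> = S'})"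
proof -
  interpret prob_space M by fact
  have fin: "finite {S'. Q S' \<and> S' \<subseteq> I}" for Q
    by (rule finite_subset[of _ "Pow I"]) (use I in auto)
  have eq: "{\<omega> \<in> space M. R \<omega> = S} = {\<omega> \<in> space M. S \<subseteq> R \<omega>} -
      (\<Union>S'\<in>{S'. S \<subset> S' \<and> S' \<subseteq> I}. {\<omega> \<in> space M. S' \<subseteq> R \<omega>})" if "S \<subseteq> I" for S
    using R that by blast
  have ev1: "{\<omega> \<in> space M. R \<omega> = S} \<in> sets M" if "S \<subseteq> I" for S
    unfolding eq[OF that]
    by (intro sets.Diff ev that sets.finite_UN fin) auto
  then show "{\<omega> \<in> space M. R \<omega> = S} \<in> sets M" using S .
  let ?Q = "{S'. S \<subset> S' \<and> S' \<subseteq> I}"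
  have "{\<omega> \<in> space M. S \<subseteq> R \<omega>} = (\<Union>S'\<in>insert S ?Q. {\<omega> \<in> space M. R \<omega> = S'})"
    using R S by blast
  moreover have "prob (\<Union>S'\<in>insert S ?Q. {\<omega> \<in> space M. R \<omega> = S'}) = (\<Sum>S'\<in>insert S ?Q. prob {\<omega> \<in> space M. R \<omega> = S'})"
    by (rule finite_measure_finite_Union) (use fin S ev1 in \<open>auto simp: disjoint_family_on_def\<close>)
  ultimately show "prob {\<omega> \<in> space M. R \<omega> = S} = prob {\<omega> \<in> space M. S \<subseteq> R \<omega>} - (\<Sum>S'\<in>?Q. prob {\<omega> \<in> space M. R \<omega> = S'})"
    using fin[of "\<lambda>S'. S \<subset> S'"] by simp
qed

text \<open>The recursion over strict supersets determines the law of \<open>R\<close> from its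
  inclusion probabilities. Passing through the discrete space of subsets of \<open>I\<close> makes
  every \<open>f\<close> measurable.\<close>

lemma distr_random_set_eqI:
  fixes R :: "'a \<Rightarrow> 'c set" and R' :: "'b \<Rightarrow> 'c set"
  assumes M: "prob_space M" and N: "prob_space N" and I: "finite I"
    and R: "\<And>\<omega>. \<omega> \<in> space M \<Longrightarrow> R \<omega> \<subseteq> I" and R': "\<And>\<omega>. \<omega> \<in> space N \<Longrightarrow> R' \<omega> \<subseteq> I"
    and ev: "\<And>S. S \<subseteq> I \<Longrightarrow> {\<omega> \<in> space M. S \<subseteq> R \<omega>} \<in> sets M"
    and ev': "\<And>S. S \<subseteq> I \<Longrightarrow> {\<omega> \<in> space N. S \<subseteq> R' \<omega>} \<in> sets N"
    and eq: "\<And>S. S \<subseteq> I \<Longrightarrow> measure M {\<omega> \<in> space M. S \<subseteq> R \<omega>} = measure N {\<omega> \<in> space N. S \<subseteq> R' \<omega>}"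
  shows "distr M (count_space UNIV) (\<lambda>\<omega>. f (R \<omega>)) = distr N (count_space UNIV) (\<lambda>\<omega>. f (R' \<omega>))"
proof -
  interpret M: prob_space M by fact
  interpret N: prob_space N by fact
  have RM: "{\<omega> \<in> space M. R \<omega> = S} \<in> sets M"
    "measure M {\<omega> \<in> space M. R \<omega> = S} =
      measure M {\<omega> \<in> space M. S \<subseteq> R \<omega>} - (\<Sum>S' | S \<subset> S' \<and> S' \<subseteq> I. measure M {\<omega> \<in> space M. R \<omega> = S'})"
    if "S \<subseteq> I" for S
    by (rule random_set_singleton_events[of M I R]; use M I R ev that in blast)+
  have RN: "{\<omega> \<in> space N. R' \<omega> = S} \<in> sets N"
    "measure N {\<omega> \<in> space N. R' \<omega> = S} =
      measure N {\<omega> \<in> space N. S \<subseteq> R' \<omega>} - (\<Sum>S' | S \<subset> S' \<and> S' \<subseteq> I. measure N {\<omega> \<in> space N. R' \<omega> = S'})"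
    if "S \<subseteq> I" for S
    by (rule random_set_singleton_events[of N I R']; use N I R' ev' that in blast)+
  have single: "measure M {\<omega> \<in> space M. R \<omega> = S} = measure N {\<omega> \<in> space N. R' \<omega> = S}" if "S \<subseteq> I" for S
    using that
  \<comment> \<open>Downward induction from \<open>S = I\<close>: strictly larger sets have smaller
    complements.\<close>
  proof (induction "card (I - S)" arbitrary: S rule: less_induct)
    case less
    have "measure M {\<omega> \<in> space M. R \<omega> = S'} = measure N {\<omega> \<in> space N. R' \<omega> = S'}" if "S \<subset> S'" "S' \<subseteq> I" for S'
      by (rule less.hyps) (use that I in \<open>auto intro!: psubset_card_mono\<close>)
    then show ?case using RM(2)[OF less.prems] RN(2)[OF less.prems] eq[OF less.prems] by simp
  qed
  have Rm: "R \<in> measurable M (count_space (Pow I))"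
    using I R RM(1) by (subst measurable_count_space_eq2) (auto simp: vimage_def Int_def conj_commute)
  have Rm': "R' \<in> measurable N (count_space (Pow I))"
    using I R' RN(1) by (subst measurable_count_space_eq2) (auto simp: vimage_def Int_def conj_commute)
  have "distr M (count_space (Pow I)) R = distr N (count_space (Pow I)) R'"
  proof (rule measure_eqI_finite[where A="Pow I"])
    fix S assume S: "S \<in> Pow I"
    have "R -` {S} \<inter> space M = {\<omega> \<in> space M. R \<omega> = S}" "R' -` {S} \<inter> space N = {\<omega> \<in> space N. R' \<omega> = S}"
      by auto
    then show "emeasure (distr M (count_space (Pow I)) R) {S} = emeasure (distr N (count_space (Pow I)) R') {S}"
      using S single[of S] by (simp add: emeasure_distr[OF Rm] emeasure_distr[OF Rm']
        M.emeasure_eq_measure N.emeasure_eq_measure)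
  qed (use I in auto)
  then have "distr (distr M (count_space (Pow I)) R) (count_space UNIV) f =
      distr (distr N (count_space (Pow I)) R') (count_space UNIV) f" by simp
  then show ?thesis by (simp add: distr_distr[OF _ Rm] distr_distr[OF _ Rm'] comp_def)
qed

theorem mainTheorem1:
  fixes M :: "'a measure" and N :: "'b measure"
    and W :: "nat \<Rightarrow> real \<Rightarrow> 'a \<Rightarrow> real" and V :: "nat \<Rightarrow> real \<Rightarrow> 'b \<Rightarrow> real"
    and x y :: "nat \<Rightarrow> real" and m n :: nat and t :: real
  assumes "m \<ge> 1" and "n \<ge> 2"
    and "\<forall>i\<in>{1..<m}. x i \<le> x (Suc i)"
    and "\<forall>j\<in>{1..<n}. y j \<le> y (Suc j)"
    and "indep_std_BMs M m W"
    and "indep_std_BMs N n V"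
    and "t \<ge> 0"
  shows "distr M (count_space UNIV)
           (\<lambda>\<omega>. \<lambda>i j. i \<in> {1..m} \<and> j \<in> {1..n-1} \<and>
                  coalescing_BM x W i t \<omega> \<in> {y j<..y (Suc j)})
       = distr N (count_space UNIV)
           (\<lambda>\<omega>. \<lambda>i j. i \<in> {1..m} \<and> j \<in> {1..n-1} \<and>
                  x i \<in> {coalescing_BM y V j t \<omega><..coalescing_BM y V (Suc j) t \<omega>})"
proof -
  interpret X: coalescing_system M m W x using assms by unfold_locales auto
  interpret Y: coalescing_system N n V y using assms by unfold_locales auto
  \<comment> \<open>All \<open>n\<close> columns are kept, one more than in the array, because
    membership in an interval compares both of its endpoints.\<close>
  let ?I = "{1..m} \<times> {1..n}"
  define C where "C \<omega> i j \<longleftrightarrow> X.X i t \<omega> \<le> y j" for \<omega> i j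
  define C' where "C' \<omega> i j \<longleftrightarrow> x i \<le> Y.X j t \<omega>" for \<omega> i j
  define R where "R \<omega> = {(i, j) \<in> ?I. C \<omega> i j}" for \<omega>
  define R' where "R' \<omega> = {(i, j) \<in> ?I. C' \<omega> i j}" for \<omega>
  \<comment> \<open>A point lies in a half-open interval when it is not at or below the left
    endpoint but is at or below the right one; the same \<open>f\<close> serves both arrays.\<close>
  define f where "f A i j \<longleftrightarrow> i \<in> {1..m} \<and> j \<in> {1..n-1} \<and> (i, j) \<notin> A \<and> (i, Suc j) \<in> A"
    for A :: "(nat \<times> nat) set" and i j
  have y_sorted: "y i \<le> y j" if "1 \<le> i" "i \<le> j" "j \<le> n" for i j
    using that(2,3)
  proof (induction j rule: dec_induct)
    case (step l)
    then show ?case using assms(4) that(1) by (auto intro: order.trans[of _ "y l"])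
  qed simp
  have x_sorted: "x i \<le> x j" if "1 \<le> i" "i \<le> j" "j \<le> m" for i j
    using that(2,3)
  proof (induction j rule: dec_induct)
    case (step l)
    then show ?case using assms(3) that(1) by (auto intro: order.trans[of _ "x l"])
  qed simp
  have R_sup: "S \<subseteq> R \<omega> \<longleftrightarrow> (\<forall>(i, j)\<in>S. C \<omega> i j)" and R'_sup: "S \<subseteq> R' \<omega>' \<longleftrightarrow> (\<forall>(i, j)\<in>S. C' \<omega>' i j)"
    if "S \<subseteq> ?I" for S \<omega> \<omega>' using that by (auto simp: R_def R'_def)
  have ev: "{\<omega> \<in> space M. S \<subseteq> R \<omega>} \<in> sets M" if S: "S \<subseteq> ?I" for S
  proof -
    have "finite S" using S by (rule finite_subset) simp
    moreover have "{\<omega> \<in> space M. C \<omega> (fst p) (snd p)} \<in> sets M" if "p \<in> S" for p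
      unfolding C_def using that S assms(7) X.X_measurable[of "fst p" t]
      by (intro borel_measurable_le) auto
    ultimately have "{\<omega> \<in> space M. \<forall>p\<in>S. C \<omega> (fst p) (snd p)} \<in> sets M"
      by (intro sets.sets_Collect_finite_All)
    then show ?thesis by (simp add: R_sup[OF S] split_beta)
  qed
  have ev': "{\<omega> \<in> space N. S \<subseteq> R' \<omega>} \<in> sets N" if S: "S \<subseteq> ?I" for S
  proof -
    have "finite S" using S by (rule finite_subset) simp
    moreover have "{\<omega> \<in> space N. C' \<omega> (fst p) (snd p)} \<in> sets N" if "p \<in> S" for p
      unfolding C'_def using that S assms(7) Y.X_measurable[of "snd p" t]
      by (intro borel_measurable_le) auto
    ultimately have "{\<omega> \<in> space N. \<forall>p\<in>S. C' \<omega> (fst p) (snd p)} \<in> sets N"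
      by (intro sets.sets_Collect_finite_All)
    then show ?thesis by (simp add: R'_sup[OF S] split_beta)
  qed
  have eq: "measure M {\<omega> \<in> space M. S \<subseteq> R \<omega>} = measure N {\<omega> \<in> space N. S \<subseteq> R' \<omega>}" if S: "S \<subseteq> ?I" for S
  \<comment> \<open>At time 0 both sets are deterministic and given by the starting points; the
    determinant formula needs positive variance.\<close>
  proof (cases "t = 0")
    case True
    have "C \<omega> i j \<longleftrightarrow> x i \<le> y j" if "\<omega> \<in> space M" "(i, j) \<in> S" for \<omega> i j
      using coalescing_pathsD(2)[OF X.paths[OF that(1)], of i] that S True by (auto simp: C_def)
    then have 1: "{\<omega> \<in> space M. S \<subseteq> R \<omega>} = {\<omega> \<in> space M. \<forall>(i, j)\<in>S. x i \<le> y j}"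
      by (auto simp: R_sup[OF S])
    have "C' \<omega> i j \<longleftrightarrow> x i \<le> y j" if "\<omega> \<in> space N" "(i, j) \<in> S" for \<omega> i j
      using coalescing_pathsD(2)[OF Y.paths[OF that(1)], of j] that S True by (auto simp: C'_def)
    then have 2: "{\<omega> \<in> space N. S \<subseteq> R' \<omega>} = {\<omega> \<in> space N. \<forall>(i, j)\<in>S. x i \<le> y j}"
      by (auto simp: R'_sup[OF S])
    define Q where "Q \<longleftrightarrow> (\<forall>(i, j)\<in>S. x i \<le> y j)"
    show ?thesis unfolding 1 2 Q_def[symmetric]
      by (cases Q) (simp_all add: X.prob_space Y.prob_space)
  next
    case False
    then have t: "0 < t" using assms(7) by simp
    show ?thesis
    proof (rule monotone_relation_staircase[OF S])
      fix k \<tau> assume k: "k \<le> m" and \<tau>: "\<And>i. i < k \<Longrightarrow> \<tau> i \<in> {1..n}"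
        and \<tau>_mono: "\<And>i j. i \<le> j \<Longrightarrow> j < k \<Longrightarrow> \<tau> i \<le> \<tau> j"
        and st: "\<And>C. (\<And>i j i' j'. C i j \<Longrightarrow> i' \<le> i \<Longrightarrow> j \<le> j' \<Longrightarrow> i \<in> {1..m} \<Longrightarrow> i' \<in> {1..m} \<Longrightarrow>
          j \<in> {1..n} \<Longrightarrow> j' \<in> {1..n} \<Longrightarrow> C i' j') \<Longrightarrow>
        (\<forall>(i, j)\<in>S. C i j) \<longleftrightarrow> (\<forall>i<k. C (Suc i) (\<tau> i))"
      have "(\<forall>(i, j)\<in>S. C \<omega> i j) \<longleftrightarrow> (\<forall>i<k. C \<omega> (Suc i) (\<tau> i))" if "\<omega> \<in> space M" for \<omega>
      proof (rule st)
        fix i j i' j' assume a: "C \<omega> i j" "i' \<le> i" "j \<le> j'" "i \<in> {1..m}" "i' \<in> {1..m}" "j \<in> {1..n}" "j' \<in> {1..n}"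
        then show "C \<omega> i' j'"
          using X.X_sorted[OF that a(5,4,2) assms(7)] y_sorted[of j j'] by (simp add: C_def)
      qed
      then have 1: "{\<omega> \<in> space M. S \<subseteq> R \<omega>} = {\<omega> \<in> space M. \<forall>i<k. X.X (Suc i) t \<omega> \<le> y (\<tau> i)}"
        unfolding R_sup[OF S] C_def by blast
      have "(\<forall>(i, j)\<in>S. C' \<omega> i j) \<longleftrightarrow> (\<forall>i<k. C' \<omega> (Suc i) (\<tau> i))" if "\<omega> \<in> space N" for \<omega>
      proof (rule st)
        fix i j i' j' assume a: "C' \<omega> i j" "i' \<le> i" "j \<le> j'" "i \<in> {1..m}" "i' \<in> {1..m}" "j \<in> {1..n}" "j' \<in> {1..n}"
        then show "C' \<omega> i' j'"
          using Y.X_sorted[OF that a(6,7,3) assms(7)] x_sorted[of i' i] by (simp add: C'_def)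
      qed
      then have 2: "{\<omega> \<in> space N. S \<subseteq> R' \<omega>} = {\<omega> \<in> space N. \<forall>i<k. x (Suc i) \<le> Y.X (\<tau> i) t \<omega>}"
        unfolding R'_sup[OF S] C'_def by blast
      \<comment> \<open>The duality: both probabilities are the same determinant, with kernels of
        \<open>y (\<tau> j) - x (Suc i)\<close>, in which the \<open>x\<close> are starting points
        for one system and fixed points for the other.\<close>
      have "measure M {\<omega> \<in> space M. S \<subseteq> R \<omega>} = shifted_det k (\<lambda>i j. gauss_cdf t (y (\<tau> j) - x (Suc i)))"
        unfolding 1
      proof (rule X.prob_X_all_le[OF t k])
        show "y (\<tau> i) \<le> y (\<tau> j)" if "i \<le> j" "j < k" for i j
          using \<tau>[of i] \<tau>[of j] \<tau>_mono[OF that] that by (intro y_sorted) auto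
      qed
      also have "\<dots> = measure N {\<omega> \<in> space N. S \<subseteq> R' \<omega>}"
        unfolding 2
      proof (rule Y.prob_X_all_ge[OF t, symmetric])
        show "\<tau> i \<in> {1..n}" if "i < k" for i using that by (rule \<tau>)
        show "\<tau> i \<le> \<tau> j" if "i \<le> j" "j < k" for i j using that by (rule \<tau>_mono)
        show "x (Suc i) \<le> x (Suc j)" if "i \<le> j" "j < k" for i j
          using that k by (intro x_sorted) auto
      qed
      finally show ?thesis .
    qed
  qed
  have "distr M (count_space UNIV) (\<lambda>\<omega>. f (R \<omega>)) = distr N (count_space UNIV) (\<lambda>\<omega>. f (R' \<omega>))"
    by (rule distr_random_set_eqI[where I="?I"])
      (use ev ev' eq X.prob_space_axioms Y.prob_space_axioms in \<open>auto simp: R_def R'_def\<close>)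
  moreover have "f (R \<omega>) = (\<lambda>i j. i \<in> {1..m} \<and> j \<in> {1..n-1} \<and> X.X i t \<omega> \<in> {y j<..y (Suc j)})" for \<omega>
    by (intro ext) (auto simp: f_def R_def C_def)
  moreover have "f (R' \<omega>) = (\<lambda>i j. i \<in> {1..m} \<and> j \<in> {1..n-1} \<and> x i \<in> {Y.X j t \<omega><..Y.X (Suc j) t \<omega>})" for \<omega>
    by (intro ext) (auto simp: f_def R'_def C'_def)
  ultimately show ?thesis by simp
qed

end
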